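(* Let $G$ be a claw-free and $K_{3,3}$-minor free graph, other than an odd cycle of order greater than three. Then $G$ is $2$-clique colorable; that is, there is a map $c: V(G)\to\{1,2\}$ such that no maximal clique of $G$ of cardinality at least two is monochromatic under $c$.
   Context: All graphs are simple and undirected. A graph is claw-free if it has no induced subgraph isomorphic to $K_{1,3}$. A clique of $G$ is a set of mutually adjacent vertices; it is maximal if it is not properly contained in another clique of $G$. A set of vertices is monochromatic under $c$ if $c$ is constant on it. A graph $F$ is a minor of $G$ if $F$ can be obtained from $G$ by a sequence of vertex deletions, edge deletions and edge contractions; $G$ is $F$-minor free if $F$ is not a minor of $G$. The order of a graph is its number of vertices.
   Formalization: The exclusion of odd cycles of order greater than three is imposed on every connected component of G, since the literal claim fails for disconnected graphs (e.g. a 5-cycle plus an isolated vertex); for connected G it is the same hypothesis. Graphs are finite. *)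

theory Defs
  imports "Graph_Theory.Graph_Theory"
begin

text \<open>
  A finite simple undirected graph is a \<^locale>\<open>pair_graph\<close>: a finite vertex set with a symmetric,
  irreflexive relation on it, so that an edge $uv$ is the pair of arcs $(u,v)$, $(v,u)$. The
  predicates \<^const>\<open>complete_bipartite_digraph\<close> and \<open>cycle_digraph\<close> below describe isomorphism
  classes, so no separate appeal to graph isomorphism is needed.
\<close>

definition claw_free :: "'a pair_pre_digraph \<Rightarrow> bool" where
  "claw_free G \<longleftrightarrow>
     \<not> (\<exists>H. induced_subgraph H (with_proj G) \<and> complete_bipartite_digraph 1 3 H)"

definition delete_vertex :: "'a pair_pre_digraph \<Rightarrow> 'a \<Rightarrow> 'a pair_pre_digraph" where
  "delete_vertex G v =
     \<lparr> pverts = pverts G - {v}, parcs = {(x, y) \<in> parcs G. x \<noteq> v \<and> y \<noteq> v} \<rparr>"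

definition delete_edge :: "'a pair_pre_digraph \<Rightarrow> 'a \<Rightarrow> 'a \<Rightarrow> 'a pair_pre_digraph" where
  "delete_edge G u v = \<lparr> pverts = pverts G, parcs = parcs G - {(u, v), (v, u)} \<rparr>"

text \<open>
  The vertex arising from the contraction of $uv$ reuses the name $u$; the loop is
  dropped and parallel edges are merged, so the result is again simple.
\<close>

definition contract_edge :: "'a pair_pre_digraph \<Rightarrow> 'a \<Rightarrow> 'a \<Rightarrow> 'a pair_pre_digraph" where
  "contract_edge G u v =
     (let f = (\<lambda>x. if x = v then u else x) in
      \<lparr> pverts = pverts G - {v},
        parcs = {(f x, f y) | x y. (x, y) \<in> parcs G \<and> f x \<noteq> f y} \<rparr>)"

inductive minor_step :: "'a pair_pre_digraph \<Rightarrow> 'a pair_pre_digraph \<Rightarrow> bool" where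
  vertex_deletion: "v \<in> pverts G \<Longrightarrow> minor_step G (delete_vertex G v)"
| edge_deletion: "(u, v) \<in> parcs G \<Longrightarrow> minor_step G (delete_edge G u v)"
| edge_contraction: "(u, v) \<in> parcs G \<Longrightarrow> minor_step G (contract_edge G u v)"

definition K33_minor_free :: "'a pair_pre_digraph \<Rightarrow> bool" where
  "K33_minor_free G \<longleftrightarrow>
     \<not> (\<exists>H. minor_step\<^sup>*\<^sup>* G H \<and> complete_bipartite_digraph 3 3 (with_proj H))"

definition cycle_digraph :: "nat \<Rightarrow> ('a, 'b) pre_digraph \<Rightarrow> bool" where
  "cycle_digraph n G \<longleftrightarrow> graph G \<and> n \<ge> 3 \<and>
     (\<exists>f. bij_betw f {..<n} (verts G) \<and>
          arcs_ends G = (\<Union>i<n. {(f i, f (Suc i mod n)), (f (Suc i mod n), f i)}))"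

text \<open>
  Since the arc relation is symmetric, the strongly connected components \<open>pre_digraph.sccs\<close> are
  the connected components. For connected $G$ the condition below says exactly that $G$ is not
  an odd cycle of order greater than three. For disconnected $G$ it must be imposed on each
  component: the disjoint union of a 5-cycle and an isolated vertex is claw-free and has no
  $K_{3,3}$ minor, but it is not 2-clique colorable.
\<close>

definition no_long_odd_cycle_component :: "'a pair_pre_digraph \<Rightarrow> bool" where
  "no_long_odd_cycle_component G \<longleftrightarrow>
     \<not> (\<exists>H \<in> pre_digraph.sccs (with_proj G). \<exists>n. odd n \<and> n > 3 \<and> cycle_digraph n H)"

definition clique :: "'a pair_pre_digraph \<Rightarrow> 'a set \<Rightarrow> bool" where
  "clique G K \<longleftrightarrow> K \<subseteq> pverts G \<and> (\<forall>u\<in>K. \<forall>v\<in>K. u \<noteq> v \<longrightarrow> (u, v) \<in> parcs G)"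

definition maximal_clique :: "'a pair_pre_digraph \<Rightarrow> 'a set \<Rightarrow> bool" where
  "maximal_clique G K \<longleftrightarrow> clique G K \<and> \<not> (\<exists>K'. clique G K' \<and> K \<subset> K')"

definition monochromatic :: "('a \<Rightarrow> nat) \<Rightarrow> 'a set \<Rightarrow> bool" where
  "monochromatic c S \<longleftrightarrow> (\<forall>x\<in>S. \<forall>y\<in>S. c x = c y)"

definition clique_colorable :: "nat \<Rightarrow> 'a pair_pre_digraph \<Rightarrow> bool" where
  "clique_colorable k G \<longleftrightarrow>
     (\<exists>c. c ` pverts G \<subseteq> {1..k} \<and>
        (\<forall>K. maximal_clique G K \<and> card K \<ge> 2 \<longrightarrow> \<not> monochromatic c K))"

end

theory Submission
  imports Defs
begin

text \<open>
  Argue on a minimal counterexample \<open>U\<close> among the induced subgraphs. Colourings of the two sides of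
  a cut vertex can be glued, so deleting a vertex leaves \<open>U\<close> connected. If a colouring of \<open>U - v\<close>
  does not extend to \<open>v\<close>, then \<open>v\<close> is blocked by two maximal cliques of its neighbourhood, each
  monochromatic, in different colours.

  No neighbourhood contains an induced 4-cycle or 5-cycle: if it consists of such a cycle, recolouring
  one or two rim vertices of a blocked wheel makes room for the hub, and any further neighbour leads
  to a \<open>K\<^sub>3\<^sub>,\<^sub>3\<close> minor. Hence two disjoint maximal cliques of a neighbourhood cover it, and such
  a pair is unique. As in the proof of Brooks' theorem, colouring greedily towards a root then
  gets stuck only at the root \<open>r\<close>, and not even there if two vertices \<open>a\<close>, \<open>b\<close> of the same clique
  of its pair receive different colours at the start. This needs \<open>U - {a, b}\<close> to be connected;
  otherwise either \<open>a\<close>, \<open>b\<close> are twins on one side of the cut and \<open>b\<close> can serve as root with \<open>a\<close>, \<open>r\<close>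
  coloured first, or both sides have a suitable root. So both cliques of every pair are single vertices
  and \<open>U\<close> is a cycle, which is even by assumption.
\<close>

section \<open>Induced cycles, maximal cliques and partial two-colourings\<close>

definition cycle_on :: "('a \<Rightarrow> 'a \<Rightarrow> bool) \<Rightarrow> nat \<Rightarrow> (nat \<Rightarrow> 'a) \<Rightarrow> 'a set \<Rightarrow> bool" where
  "cycle_on E n f D \<longleftrightarrow> bij_betw f {..<n} D \<and>
     (\<forall>i<n. \<forall>j<n. E (f i) (f j) \<longleftrightarrow> j = Suc i mod n \<or> i = Suc j mod n)"

text \<open>The only \<open>K\<^sub>3\<^sub>,\<^sub>3\<close> minors needed have five singleton branch sets, the sixth one
  being \<open>{s, t}\<close>, hence arise by at most one contraction.\<close>

locale sparse_claw_free =
  fixes E :: "'a \<Rightarrow> 'a \<Rightarrow> bool" and V :: "'a set"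
  assumes finite_V: "finite V"
    and E_V: "E x y \<Longrightarrow> x \<in> V"
    and E_sym: "E x y \<Longrightarrow> E y x"
    and E_irrefl: "\<not> E x x"
    and claw: "\<lbrakk>E v x; E v y; E v z; x \<noteq> y; x \<noteq> z; y \<noteq> z\<rbrakk> \<Longrightarrow> E x y \<or> E x z \<or> E y z"
    and K33: "\<lbrakk>E x1 y1; E x2 y1; E x3 y1; E x1 y2; E x2 y2; E x3 y2;
        E x1 s \<or> E x1 t; E x2 s \<or> E x2 t; E x3 s \<or> E x3 t; s = t \<or> E s t;
        distinct [x1, x2, x3]; distinct [y1, y2, s]; t \<noteq> y1; t \<noteq> y2;
        {x1, x2, x3} \<inter> {y1, y2, s, t} = {}\<rbrakk> \<Longrightarrow> False"
begin

definition nbhd :: "'a set \<Rightarrow> 'a \<Rightarrow> 'a set" where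
  "nbhd U v = {x \<in> U. E v x}"

definition max_clique :: "'a set \<Rightarrow> 'a set \<Rightarrow> bool" where
  "max_clique U K \<longleftrightarrow> K \<subseteq> U \<and> (\<forall>x\<in>K. \<forall>y\<in>K. x \<noteq> y \<longrightarrow> E x y) \<and> (\<forall>x\<in>U - K. \<exists>y\<in>K. \<not> E x y)"

text \<open>\<open>T\<close> is the coloured part of \<open>U\<close>; values of \<open>c\<close>
  outside \<open>T\<close> do not matter. Only cliques that are maximal in all of \<open>U\<close>
  count, so a clique that an uncoloured vertex still enlarges imposes no condition.\<close>

definition valid_on :: "'a set \<Rightarrow> 'a set \<Rightarrow> ('a \<Rightarrow> bool) \<Rightarrow> bool" where
  "valid_on U T c \<longleftrightarrow>
     (\<forall>K. max_clique U K \<and> K \<subseteq> T \<and> (\<exists>x\<in>K. \<exists>y\<in>K. x \<noteq> y) \<longrightarrow> (\<exists>x\<in>K. \<exists>y\<in>K. c x \<noteq> c y))"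

text \<open>Such a \<open>D\<close> is a union of components of the subgraph induced by
  \<open>U\<close>, which expresses connectivity without paths.\<close>

definition closed_in :: "'a set \<Rightarrow> 'a set \<Rightarrow> bool" where
  "closed_in U D \<longleftrightarrow> D \<subseteq> U \<and> (\<forall>x\<in>D. \<forall>y\<in>U. E x y \<longrightarrow> y \<in> D)"

definition long_odd_component :: "'a set \<Rightarrow> 'a set \<Rightarrow> bool" where
  "long_odd_component U D \<longleftrightarrow>
     closed_in U D \<and> (\<exists>n f. odd n \<and> n > 3 \<and> cycle_on E n f D)"

lemma max_cliqueD:
  assumes "max_clique U K"
  shows "x \<in> K \<Longrightarrow> x \<in> U" and "x \<in> K \<Longrightarrow> y \<in> K \<Longrightarrow> x \<noteq> y \<Longrightarrow> E x y"
    and "x \<in> U \<Longrightarrow> (\<And>y. y \<in> K \<Longrightarrow> x \<noteq> y \<Longrightarrow> E x y) \<Longrightarrow> x \<in> K"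
  using assms E_irrefl unfolding max_clique_def by blast+

lemma max_clique_nonadj:
  assumes "max_clique U K" "x \<in> U" "x \<notin> K"
  obtains y where "y \<in> K" "\<not> E x y" "x \<noteq> y"
  using assms unfolding max_clique_def by blast

lemma max_clique_Diff:
  assumes "max_clique U K" "x \<notin> K"
  shows "max_clique (U - {x}) K"
  using assms unfolding max_clique_def by blast

lemma in_nbhd: "x \<in> nbhd U v \<longleftrightarrow> x \<in> U \<and> E v x"
  by (simp add: nbhd_def)

lemma long_odd_component_nbhd:
  assumes "long_odd_component U D" "x \<in> D"
  obtains y z where "y \<noteq> z" "\<not> E y z" "nbhd U x = {y, z}" "y \<in> D" "z \<in> D"
proof -
  obtain n f where n: "odd n" "n > 3" "cycle_on E n f D" and cl: "closed_in U D"
    using assms unfolding long_odd_component_def by blast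
  have bij: "bij_betw f {..<n} D"
    and adj: "\<And>i j. i < n \<Longrightarrow> j < n \<Longrightarrow> E (f i) (f j) \<longleftrightarrow> j = Suc i mod n \<or> i = Suc j mod n"
    using n unfolding cycle_on_def by auto
  obtain i where i: "i < n" "x = f i"
    using bij assms(2) by (auto simp: bij_betw_def)
  \<comment> \<open>\<open>j\<close> and \<open>k\<close> are the cyclic successor and predecessor
    of \<open>i\<close>; \<open>n > 3\<close> makes them nonadjacent.\<close>
  define j where "j = Suc i mod n"
  define k where "k = (if i = 0 then n - 1 else i - 1)"
  have jk: "j < n" "k < n" "j \<noteq> k" using i n by (auto simp: j_def k_def mod_Suc)
  have ij: "\<And>l. l < n \<Longrightarrow> l = Suc i mod n \<or> i = Suc l mod n \<longleftrightarrow> l = j \<or> l = k"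
    using i n by (auto simp: j_def k_def mod_Suc)
  have njk: "\<not> (k = Suc j mod n \<or> j = Suc k mod n)"
    using i n by (auto simp: j_def k_def mod_Suc split: if_splits)
  show ?thesis
  proof
    show "f j \<noteq> f k" using bij jk by (auto simp: bij_betw_def inj_on_def)
    show "\<not> E (f j) (f k)" using adj jk njk by blast
    show "f j \<in> D" "f k \<in> D" using bij jk by (auto simp: bij_betw_def)
    show "nbhd U x = {f j, f k}"
    proof (intro equalityI subsetI)
      fix y assume "y \<in> nbhd U x"
      then have "y \<in> D" "E x y" using cl assms(2) unfolding closed_in_def nbhd_def by auto
      then obtain l where l: "l < n" "y = f l" using bij by (auto simp: bij_betw_def)
      then show "y \<in> {f j, f k}" using adj[of i l] ij[of l] i \<open>E x y\<close> by auto
    next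
      fix y assume "y \<in> {f j, f k}"
      moreover have "D \<subseteq> U" using cl by (simp add: closed_in_def)
      ultimately show "y \<in> nbhd U x"
        using adj[of i j] adj[of i k] ij[of j] ij[of k] i jk \<open>f j \<in> D\<close> \<open>f k \<in> D\<close> by (auto simp: nbhd_def)
    qed
  qed
qed

lemma valid_onI:
  assumes "\<And>K x y. max_clique U K \<Longrightarrow> K \<subseteq> T \<Longrightarrow> x \<in> K \<Longrightarrow> y \<in> K \<Longrightarrow> x \<noteq> y
      \<Longrightarrow> \<exists>b. \<forall>z\<in>K. c z = b \<Longrightarrow> False"
  shows "valid_on U T c"
  unfolding valid_on_def
proof (intro allI impI)
  fix K assume K: "max_clique U K \<and> K \<subseteq> T \<and> (\<exists>x\<in>K. \<exists>y\<in>K. x \<noteq> y)"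
  then obtain x y where xy: "x \<in> K" "y \<in> K" "x \<noteq> y" by blast
  show "\<exists>x\<in>K. \<exists>y\<in>K. c x \<noteq> c y"
  proof (rule ccontr)
    assume "\<not> (\<exists>x\<in>K. \<exists>y\<in>K. c x \<noteq> c y)"
    then have "\<forall>z\<in>K. c z = c x" using xy by blast
    then show False using assms K xy by blast
  qed
qed

lemma valid_onD:
  assumes "valid_on U T c" "max_clique U K" "K \<subseteq> T" "x \<in> K" "y \<in> K" "x \<noteq> y" "\<forall>z\<in>K. c z = b"
  shows False
  using assms unfolding valid_on_def by metis

lemma max_clique_remove:
  assumes K: "max_clique U K" and "v \<in> K"
  shows "max_clique (nbhd U v) (K - {v})"
  unfolding max_clique_def
proof (intro conjI ballI)
  show "K - {v} \<subseteq> nbhd U v"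
  proof
    fix z assume "z \<in> K - {v}"
    then show "z \<in> nbhd U v"
      using max_cliqueD(1)[OF K, of z] max_cliqueD(2)[OF K \<open>v \<in> K\<close>, of z] by (auto simp: in_nbhd)
  qed
  show "x \<noteq> y \<longrightarrow> E x y" if "x \<in> K - {v}" "y \<in> K - {v}" for x y
    using max_cliqueD(2)[OF K] that by blast
  fix x assume x: "x \<in> nbhd U v - (K - {v})"
  then have "x \<in> U" "x \<notin> K" "E x v" using E_irrefl E_sym by (auto simp: in_nbhd)
  then obtain y where "y \<in> K" "\<not> E x y" by (meson max_clique_nonadj K)
  then show "\<exists>y\<in>K - {v}. \<not> E x y" using \<open>E x v\<close> by blast
qed

text \<open>A clique spoiled by giving \<open>v\<close> the colour \<open>b\<close> contains
  \<open>v\<close>, and the rest of it is a maximal clique of the neighbourhood in colour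
  \<open>b\<close>. If both colours fail, each colour has such a clique.\<close>

lemma valid_extend:
  assumes ok: "valid_on U T c" and v: "v \<in> U" "v \<notin> T"
  obtains c' where "valid_on U (insert v T) c'" "\<And>x. x \<noteq> v \<Longrightarrow> c' x = c x"
  | Q1 Q2 where "max_clique (nbhd U v) Q1" "Q1 \<subseteq> T" "\<And>x. x \<in> Q1 \<Longrightarrow> c x"
      "max_clique (nbhd U v) Q2" "Q2 \<subseteq> T" "\<And>x. x \<in> Q2 \<Longrightarrow> \<not> c x"
proof -
  have blocked: "valid_on U (insert v T) (c(v := b))"
    if none: "\<not> (\<exists>Q. max_clique (nbhd U v) Q \<and> Q \<subseteq> T \<and> (\<forall>x\<in>Q. c x = b))" for b
  proof (rule valid_onI)
    fix K x y
    assume K: "max_clique U K" "K \<subseteq> insert v T" and xy: "x \<in> K" "y \<in> K" "x \<noteq> y"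
      and "\<exists>b'. \<forall>z\<in>K. (c(v := b)) z = b'"
    then obtain b' where b': "\<And>z. z \<in> K \<Longrightarrow> (c(v := b)) z = b'" by blast
    have "v \<in> K"
    proof (rule ccontr)
      assume "v \<notin> K"
      have "c z = b'" if "z \<in> K" for z
        using b'[OF that] that \<open>v \<notin> K\<close> by (cases "z = v") auto
      then show False using valid_onD[OF ok K(1) _ xy] K(2) \<open>v \<notin> K\<close> by blast
    qed
    have "max_clique (nbhd U v) (K - {v})" by (rule max_clique_remove[OF K(1) \<open>v \<in> K\<close>])
    moreover have "c z = b" if "z \<in> K - {v}" for z
      using b'[of z] b'[OF \<open>v \<in> K\<close>] that by auto
    moreover have "K - {v} \<subseteq> T" using K by blast
    ultimately show False using none by blast
  qed
  show ?thesis
  proof (cases "\<exists>b. valid_on U (insert v T) (c(v := b))")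
    case True
    then show ?thesis using that(1) by (metis fun_upd_other)
  next
    case False
    then have "\<exists>Q. max_clique (nbhd U v) Q \<and> Q \<subseteq> T \<and> (\<forall>x\<in>Q. c x = b)" for b
      using blocked by blast
    from this[of True] this[of False] show ?thesis using that(2) by auto
  qed
qed

text \<open>Let \<open>W\<close> be the neighbours of \<open>i\<close> other than \<open>p\<close>,
  \<open>q\<close>, \<open>r\<close>. None of them is adjacent to \<open>r\<close>, so claws at
  \<open>i\<close> show that \<open>W\<close> is a clique and that each of its vertices is adjacent
  to \<open>p\<close> or \<open>q\<close>. As \<open>K\<close> lies in \<open>W\<close> together
  with \<open>i\<close> and \<open>q\<close>, every common neighbour of \<open>i\<close> and
  \<open>q\<close> except \<open>r\<close> belongs to \<open>K\<close>. If there were none,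
  \<open>K\<close> could be enlarged by \<open>r\<close> or by \<open>p\<close>.\<close>

lemma max_clique_fork:
  assumes "i \<in> U" "r \<in> U" "p \<in> U" "q \<in> U"
    and "E r i" "E r p" "E r q" "E i p" "E i q" "\<not> E p q" "p \<noteq> q"
    and only: "\<forall>z\<in>nbhd U r. E i z \<longrightarrow> z = p \<or> z = q"
    and K: "max_clique U K" "i \<in> K" "r \<notin> K" "p \<notin> K"
  shows "{z \<in> U. E i z \<and> E q z \<and> z \<noteq> r} \<noteq> {}" (is "?M \<noteq> {}")
    and "{z \<in> U. E i z \<and> E q z \<and> z \<noteq> r} \<subseteq> K"
proof -
  define W where "W = {z \<in> U. E i z \<and> z \<notin> {p, q, r}}"
  have W_nr: "\<not> E r z" if "z \<in> W" for z using only that by (auto simp: W_def in_nbhd)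
  have W_clique: "E y z" if "y \<in> W" "z \<in> W" "y \<noteq> z" for y z
    using claw[of i r y z] W_nr that assms E_sym by (auto simp: W_def)
  have W_pq: "E p z \<or> E q z" if "z \<in> W" for z
    using claw[of i p q z] that assms by (auto simp: W_def)
  have K_sub: "K \<subseteq> insert i (insert q W)"
    using max_cliqueD[OF K(1)] K by (auto simp: W_def)
  have M_W: "?M \<subseteq> W" using assms E_irrefl E_sym by (auto simp: W_def)
  show MK: "?M \<subseteq> K"
  proof
    fix z assume z: "z \<in> ?M"
    then have "z \<in> W" using M_W by blast
    show "z \<in> K"
    proof (rule max_cliqueD(3)[OF K(1)])
      show "z \<in> U" using z by simp
      show "E z y" if "y \<in> K" "z \<noteq> y" for y
        using that K_sub z W_clique[OF \<open>z \<in> W\<close>, of y] E_sym by blast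
    qed
  qed
  show "?M \<noteq> {}"
  proof
    assume M: "?M = {}"
    show False
    proof (cases "q \<in> K")
      case True
      have "K \<subseteq> {i, q}"
      proof
        fix z assume z: "z \<in> K"
        show "z \<in> {i, q}"
        proof (rule ccontr)
          assume "z \<notin> {i, q}"
          then have "E i z" "E q z" "z \<in> U" using max_cliqueD[OF K(1)] z True K by auto
          then show False using M z K by auto
        qed
      qed
      then show False using max_cliqueD(3)[OF K(1), of r] assms E_sym by blast
    next
      case False
      have "E p y" if "y \<in> K" for y
        using that K_sub False W_pq[of y] M E_sym assms unfolding W_def by blast
      then show False using max_cliqueD(3)[OF K(1), of p] assms by blast
    qed
  qed
qed

definition colorable :: "'a set \<Rightarrow> bool" where
  "colorable U \<longleftrightarrow> (\<exists>c. valid_on U U c)"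

lemma valid_on_flip: "valid_on U T (\<lambda>x. \<not> c x) \<longleftrightarrow> valid_on U T c"
  by (simp add: valid_on_def)

end


section \<open>Greedy colouring\<close>

context sparse_claw_free
begin

section \<open>Disjoint maximal cliques in a neighbourhood\<close>

definition tame :: "'a set \<Rightarrow> bool" where
  "tame U \<longleftrightarrow> (\<forall>v a b c d. v \<in> U \<and> {a, b, c, d} \<subseteq> nbhd U v \<and> distinct [a, b, c, d] \<longrightarrow>
      \<not> (E a b \<and> E b c \<and> E c d \<and> E d a \<and> \<not> E a c \<and> \<not> E b d)) \<and>
    (\<forall>v a b c d e. v \<in> U \<and> {a, b, c, d, e} \<subseteq> nbhd U v \<and> distinct [a, b, c, d, e] \<longrightarrow>
      \<not> (E a b \<and> E b c \<and> E c d \<and> E d e \<and> E e a \<and>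
         \<not> E a c \<and> \<not> E b d \<and> \<not> E c e \<and> \<not> E d a \<and> \<not> E e b))"

lemma tame_C4:
  assumes "tame U" "v \<in> U" "{a, b, c, d} \<subseteq> nbhd U v" "distinct [a, b, c, d]"
    "E a b" "E b c" "E c d" "E d a" "\<not> E a c" "\<not> E b d"
  shows False
  using assms unfolding tame_def by blast

lemma tame_C5:
  assumes "tame U" "v \<in> U" "{a, b, c, d, e} \<subseteq> nbhd U v" "distinct [a, b, c, d, e]"
    "E a b" "E b c" "E c d" "E d e" "E e a"
    "\<not> E a c" "\<not> E b d" "\<not> E c e" "\<not> E d a" "\<not> E e b"
  shows False
  using assms unfolding tame_def by blast

lemma nbhd_claw:
  assumes "x \<in> nbhd U v" "y \<in> nbhd U v" "z \<in> nbhd U v" "x \<noteq> y" "x \<noteq> z" "y \<noteq> z"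
    "\<not> E x y" "\<not> E x z"
  shows "E y z"
  using assms claw[of v x y z] by (auto simp: in_nbhd)

text \<open>An uncovered \<open>x\<close> has nonneighbours \<open>y1\<close> in \<open>Q1\<close>
  and \<open>y2\<close> in \<open>Q2\<close>, which are adjacent by claw-freeness. These have
  nonneighbours \<open>z2\<close> and \<open>z1\<close> in the opposite cliques, and
  \<open>x\<close> is adjacent to both. Then \<open>y1\<close>, \<open>y2\<close>,
  \<open>z2\<close>, \<open>z1\<close> form an induced 4-cycle, or an induced 5-cycle with
  \<open>x\<close> inserted between \<open>z2\<close> and \<open>z1\<close>.\<close>

lemma max_cliques_cover:
  assumes tame: "tame U" and v: "v \<in> U"
    and Q1: "max_clique (nbhd U v) Q1" and Q2: "max_clique (nbhd U v) Q2"
    and disj: "Q1 \<inter> Q2 = {}"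
  shows "nbhd U v \<subseteq> Q1 \<union> Q2"
proof
  fix x assume x: "x \<in> nbhd U v"
  show "x \<in> Q1 \<union> Q2"
  proof (rule ccontr)
    assume xn: "x \<notin> Q1 \<union> Q2"
    obtain y1 where y1: "y1 \<in> Q1" "\<not> E x y1" "x \<noteq> y1"
      using max_clique_nonadj[OF Q1 x] xn by blast
    obtain y2 where y2: "y2 \<in> Q2" "\<not> E x y2" "x \<noteq> y2"
      using max_clique_nonadj[OF Q2 x] xn by blast
    have N: "z \<in> nbhd U v" if "z \<in> Q1 \<union> Q2" for z
      using that max_cliqueD(1)[OF Q1] max_cliqueD(1)[OF Q2] by blast
    have "y1 \<noteq> y2" using disj y1 y2 by blast
    have y12: "E y1 y2"
      using nbhd_claw[OF x N[of y1] N[of y2]] y1 y2 \<open>y1 \<noteq> y2\<close> by blast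
    obtain z2 where z2: "z2 \<in> Q2" "\<not> E y1 z2" "y1 \<noteq> z2"
      using max_clique_nonadj[OF Q2 N[of y1]] y1 disj by blast
    obtain z1 where z1: "z1 \<in> Q1" "\<not> E y2 z1" "y2 \<noteq> z1"
      using max_clique_nonadj[OF Q1 N[of y2]] y2 disj by blast
    have ne: "z1 \<noteq> y1" "z2 \<noteq> y2" "z1 \<noteq> z2" "x \<noteq> z1" "x \<noteq> z2"
      using y12 z1 z2 E_sym disj xn by blast+
    have e: "E y1 z1" "E y2 z2"
      using max_cliqueD(2)[OF Q1] max_cliqueD(2)[OF Q2] y1 y2 z1 z2 ne by blast+
    have "E x z1"
      using nbhd_claw[OF N[of y2] x N[of z1]] y2 z1 ne E_sym by blast
    have "E x z2"
      using nbhd_claw[OF N[of y1] x N[of z2]] y1 z2 ne E_sym by blast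
    have in_N: "{y1, y2, z1, z2, x} \<subseteq> nbhd U v" using N x y1 y2 z1 z2 by blast
    show False
    proof (cases "E z1 z2")
      case True
      show False
        by (rule tame_C4[OF tame v, of y1 y2 z2 z1])
          (use in_N ne y1 y2 z1 z2 y12 e True \<open>y1 \<noteq> y2\<close> E_sym in auto)
    next
      case False
      show False
        by (rule tame_C5[OF tame v, of y1 y2 z2 x z1])
          (use in_N ne y1 y2 z1 z2 y12 e False \<open>y1 \<noteq> y2\<close> \<open>E x z1\<close> \<open>E x z2\<close> E_sym in auto)
    qed
  qed
qed

text \<open>Otherwise \<open>b\<close> lies in \<open>R2\<close>. A nonneighbour \<open>p\<close> of
  \<open>b\<close> in \<open>R1\<close> and a nonneighbour \<open>q\<close> of \<open>a\<close> in
  \<open>R2\<close> both fall into \<open>Q2\<close>, so \<open>a\<close>, \<open>b\<close>,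
  \<open>q\<close>, \<open>p\<close> form an induced 4-cycle.\<close>

lemma max_cliques_pair_unique:
  assumes tame: "tame U" and v: "v \<in> U"
    and Q1: "max_clique (nbhd U v) Q1" and Q2: "max_clique (nbhd U v) Q2" and disj: "Q1 \<inter> Q2 = {}"
    and R1: "max_clique (nbhd U v) R1" and R2: "max_clique (nbhd U v) R2" and disj': "R1 \<inter> R2 = {}"
    and ab: "a \<in> Q1" "b \<in> Q1" "a \<noteq> b" and aR: "a \<in> R1" 
  shows "b \<in> R1"
proof (rule ccontr)
  assume "b \<notin> R1"
  have N: "z \<in> nbhd U v" if "z \<in> Q1 \<union> R1 \<union> R2" for z
    using that max_cliqueD(1)[OF Q1] max_cliqueD(1)[OF R1] max_cliqueD(1)[OF R2] by blast
  have "b \<in> R2"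
    using max_cliques_cover[OF tame v R1 R2 disj'] N ab \<open>b \<notin> R1\<close> by blast
  obtain p where p: "p \<in> R1" "\<not> E b p" "b \<noteq> p"
    using max_clique_nonadj[OF R1 N[of b]] ab \<open>b \<notin> R1\<close> by blast
  obtain q where q: "q \<in> R2" "\<not> E a q" "a \<noteq> q"
    using max_clique_nonadj[OF R2 N[of a]] ab aR disj' by blast
  have "E a b" using max_cliqueD(2)[OF Q1] ab by blast
  have "a \<noteq> p" "b \<noteq> q" using \<open>E a b\<close> p q E_sym by blast+
  have "p \<notin> Q1" "q \<notin> Q1" using max_cliqueD(2)[OF Q1] ab p q by blast+
  then have "p \<in> Q2" "q \<in> Q2"
    using max_cliques_cover[OF tame v Q1 Q2 disj] N p q by blast+
  have "E a p" "E b q"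
    using max_cliqueD(2)[OF R1] max_cliqueD(2)[OF R2] p q aR \<open>b \<in> R2\<close> \<open>a \<noteq> p\<close> \<open>b \<noteq> q\<close> by blast+
  have "p \<noteq> q" using \<open>E a p\<close> q by blast
  then have "E p q" using max_cliqueD(2)[OF Q2] \<open>p \<in> Q2\<close> \<open>q \<in> Q2\<close> by blast
  show False
    by (rule tame_C4[OF tame v, of a b q p])
      (use N ab p q \<open>E a b\<close> \<open>E b q\<close> \<open>E p q\<close> \<open>E a p\<close> \<open>a \<noteq> p\<close> \<open>b \<noteq> q\<close> \<open>p \<noteq> q\<close> E_sym in auto)
qed

text \<open>However the colouring of \<open>P\<close> is extended, one clique of each disjoint pair
  shows both colours, so \<open>v\<close> is never blocked. For empty \<open>P\<close> it means that
  there is no disjoint pair at all.\<close>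

definition safe :: "'a set \<Rightarrow> 'a set \<Rightarrow> ('a \<Rightarrow> bool) \<Rightarrow> 'a \<Rightarrow> bool" where
  "safe U P c v \<longleftrightarrow> (\<forall>Q1 Q2. max_clique (nbhd U v) Q1 \<and> max_clique (nbhd U v) Q2 \<and> Q1 \<inter> Q2 = {}
     \<longrightarrow> (\<exists>x\<in>P. \<exists>y\<in>P. c x \<noteq> c y \<and> (x \<in> Q1 \<and> y \<in> Q1 \<or> x \<in> Q2 \<and> y \<in> Q2)))"

text \<open>Greedy colouring towards the safe roots, as in the proof of Brooks' theorem: a neighbour
  of \<open>v\<close> that is still uncoloured cannot lie in either of two blocking cliques, which
  however cover the neighbourhood of \<open>v\<close>.\<close>

lemma greedy_colorable:
  fixes d :: "'a \<Rightarrow> nat"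
  assumes tame: "tame U" and fin: "finite U" and P: "P \<subseteq> U" "valid_on U P c0"
    and root: "\<And>v. v \<in> U - P \<Longrightarrow> safe U P c0 v \<or> (\<exists>w\<in>U - P. E v w \<and> d w < d v)"
  shows "colorable U"
proof -
  \<comment> \<open>\<open>k\<close> counts the uncoloured vertices. The last conjunct records that
    ranks outside \<open>P\<close> are coloured in descending order.\<close>
  have "\<exists>T c. P \<subseteq> T \<and> T \<subseteq> U \<and> card (U - T) = k \<and> valid_on U T c \<and> (\<forall>x\<in>P. c x = c0 x) \<and>
      (\<forall>w\<in>T - P. \<forall>u\<in>U - T. d u \<le> d w)" if "k \<le> card (U - P)" for k
    using that
  proof (induction "card (U - P) - k" arbitrary: k)
    case 0
    then have "k = card (U - P)" by simp
    then show ?case using P by (intro exI[of _ P] exI[of _ c0]) auto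
  next
    case (Suc m)
    then have "m = card (U - P) - Suc k" "Suc k \<le> card (U - P)" by auto
    then obtain T c where T: "P \<subseteq> T" "T \<subseteq> U" "card (U - T) = Suc k" and c: "valid_on U T c"
      and cP: "\<forall>x\<in>P. c x = c0 x" and d: "\<forall>w\<in>T - P. \<forall>u\<in>U - T. d u \<le> d w"
      using Suc(1) by blast
    have "finite (d ` (U - T))" using fin by simp
    moreover have "d ` (U - T) \<noteq> {}" using T(3) by (metis card.empty image_is_empty nat.distinct(1))
    \<comment> \<open>The next vertex has the largest uncoloured rank, so a neighbour outside
      \<open>P\<close> of smaller rank is still uncoloured.\<close>
    ultimately obtain v where v: "v \<in> U - T" and "d v = Max (d ` (U - T))"
      using Max_in by (metis imageE)
    then have vmax: "\<And>u. u \<in> U - T \<Longrightarrow> d u \<le> d v"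
      using \<open>finite (d ` (U - T))\<close> by simp
    show ?case
    proof (rule valid_extend[OF c, of v])
      show "v \<in> U" "v \<notin> T" using v by auto
    next
      fix c' assume c': "valid_on U (insert v T) c'" "\<And>x. x \<noteq> v \<Longrightarrow> c' x = c x"
      have "card (U - insert v T) = k"
        using T v fin by (metis Diff_insert card_Diff_singleton diff_Suc_1)
      moreover have "\<forall>x\<in>P. c' x = c0 x" using c'(2) cP v T(1) by (metis DiffD2 subsetD)
      moreover have "\<forall>w\<in>insert v T - P. \<forall>u\<in>U - insert v T. d u \<le> d w"
        using d vmax by auto
      ultimately show ?thesis
        using c' T v by (intro exI[of _ "insert v T"] exI[of _ c']) auto
    next
      fix Q1 Q2
      assume Q1: "max_clique (nbhd U v) Q1" "Q1 \<subseteq> T" "\<And>x. x \<in> Q1 \<Longrightarrow> c x"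
        and Q2: "max_clique (nbhd U v) Q2" "Q2 \<subseteq> T" "\<And>x. x \<in> Q2 \<Longrightarrow> \<not> c x"
      have disj: "Q1 \<inter> Q2 = {}" using Q1(3) Q2(3) by blast
      have "v \<in> U - P" using v T by blast
      from root[OF this] show ?thesis
      proof
        assume "safe U P c0 v"
        then obtain x y where "x \<in> P" "y \<in> P" "c0 x \<noteq> c0 y" "x \<in> Q1 \<and> y \<in> Q1 \<or> x \<in> Q2 \<and> y \<in> Q2"
          using Q1(1) Q2(1) disj unfolding safe_def by blast
        then show ?thesis using Q1(3) Q2(3) cP by metis
      next
        assume "\<exists>w\<in>U - P. E v w \<and> d w < d v"
        then obtain w where w: "w \<in> U - P" "E v w" "d w < d v" by blast
        then have "\<not> d v \<le> d w" by simp
        then have "w \<notin> T" using d v w by blast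
        moreover have "w \<in> Q1 \<union> Q2"
          using max_cliques_cover[OF tame _ Q1(1) Q2(1) disj] v w by (auto simp: in_nbhd)
        ultimately show ?thesis using Q1(2) Q2(2) by blast
      qed
    qed
  qed
  from this[of 0] obtain T c where "T \<subseteq> U" "card (U - T) = 0" "valid_on U T c" by auto
  moreover from this have "T = U" using fin by auto
  ultimately show ?thesis unfolding colorable_def by blast
qed

section \<open>Connectivity, distance ranks and gluing of colourings\<close>

definition linked :: "'a set \<Rightarrow> bool" where
  "linked X \<longleftrightarrow> (\<forall>Z. closed_in X Z \<longrightarrow> Z = {} \<or> Z = X)"

lemma closed_in_Diff: "closed_in X Z \<Longrightarrow> closed_in X (X - Z)"
  unfolding closed_in_def using E_sym by blast

text \<open>The rank is the distance from \<open>r\<close>: the vertices reached by walks from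
  \<open>r\<close> form a closed set, hence all of \<open>X\<close>.\<close>

lemma linked_rank:
  assumes "linked X" "r \<in> X"
  obtains d :: "'a \<Rightarrow> nat" where "\<And>v. v \<in> X \<Longrightarrow> v \<noteq> r \<Longrightarrow> \<exists>w\<in>X. E v w \<and> d w < d v"
proof -
  define R where "R = {(x, y). x \<in> X \<and> y \<in> X \<and> E x y}"
  define Z where "Z = {x \<in> X. \<exists>n. (r, x) \<in> R ^^ n}"
  have "closed_in X Z"
    unfolding closed_in_def
  proof (intro conjI ballI impI)
    show "Z \<subseteq> X" by (auto simp: Z_def)
    fix x y assume "x \<in> Z" "y \<in> X" "E x y"
    then obtain n where "(r, x) \<in> R ^^ n" "(x, y) \<in> R" by (auto simp: Z_def R_def)
    then have "(r, y) \<in> R ^^ Suc n" by auto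
    then show "y \<in> Z" using \<open>y \<in> X\<close> unfolding Z_def by blast
  qed
  moreover have "r \<in> Z" using assms(2) by (auto simp: Z_def intro: exI[of _ 0])
  ultimately have Z: "Z = X" using assms(1) unfolding linked_def by blast
  define d where "d v = (LEAST n. (r, v) \<in> R ^^ n)" for v
  show ?thesis
  proof
    fix v assume v: "v \<in> X" "v \<noteq> r"
    then obtain n where "(r, v) \<in> R ^^ n" using Z by (auto simp: Z_def)
    then have dv: "(r, v) \<in> R ^^ d v" unfolding d_def by (rule LeastI)
    show "\<exists>w\<in>X. E v w \<and> d w < d v"
    proof (cases "d v")
      case 0
      then show ?thesis using dv v by simp
    next
      case (Suc m)
      then obtain w where w: "(r, w) \<in> R ^^ m" "(w, v) \<in> R" using dv by auto
      then have "d w \<le> m" unfolding d_def by (intro Least_le)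
      then show ?thesis using w Suc E_sym by (auto simp: R_def intro!: bexI[of _ w])
    qed
  qed
qed

text \<open>Every maximal clique lies within one side, and the two colours can be swapped on
  \<open>Y\<close> to make both colourings agree at \<open>v\<close>.\<close>

lemma separated_colorable:
  assumes U: "U = X \<union> Y" and cut: "X \<inter> Y \<subseteq> {v}"
    and sep: "\<And>x y. x \<in> X - Y \<Longrightarrow> y \<in> Y - X \<Longrightarrow> \<not> E x y"
    and "colorable X" "colorable Y"
  shows "colorable U"
proof -
  obtain cX cY' where cX: "valid_on X X cX" and cY': "valid_on Y Y cY'"
    using assms unfolding colorable_def by blast
  obtain cY where cY: "valid_on Y Y cY" and v: "cY v = cX v"
    using cY' valid_on_flip[of Y Y cY'] by (cases "cY' v = cX v") auto
  define c where "c x = (if x \<in> X then cX x else cY x)" for x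
  have c: "\<And>x. x \<in> X \<Longrightarrow> c x = cX x" "\<And>x. x \<in> Y \<Longrightarrow> c x = cY x"
    using cut v by (auto simp: c_def)
  have mc: "max_clique W K" if "max_clique U K" "K \<subseteq> W" "W \<subseteq> U" for K W
    using that unfolding max_clique_def by blast
  have "valid_on U U c"
  proof (rule valid_onI)
    fix K x y assume K: "max_clique U K" and xy: "x \<in> K" "y \<in> K" "x \<noteq> y" and mono: "\<exists>b. \<forall>z\<in>K. c z = b"
    have "K \<subseteq> X \<or> K \<subseteq> Y"
    proof (rule ccontr)
      assume "\<not> (K \<subseteq> X \<or> K \<subseteq> Y)"
      then obtain x' y' where "x' \<in> K" "x' \<notin> Y" "y' \<in> K" "y' \<notin> X" by blast
      moreover have "x' \<in> X" "y' \<in> Y" using calculation max_cliqueD(1)[OF K] U by auto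
      ultimately show False using max_cliqueD(2)[OF K, of x' y'] sep[of x' y'] by blast
    qed
    then show False
    proof
      assume "K \<subseteq> X"
      then show False using valid_onD[OF cX mc[OF K] _ xy] mono U c(1) by (metis Un_upper1 subsetD)
    next
      assume "K \<subseteq> Y"
      then show False using valid_onD[OF cY mc[OF K] _ xy] mono U c(2) by (metis Un_upper2 subsetD)
    qed
  qed
  then show ?thesis unfolding colorable_def by blast
qed

text \<open>Such a vertex lies in every maximal clique, so a colour used by it alone
  suffices.\<close>

lemma universal_colorable:
  assumes "v \<in> U" "\<And>x. x \<in> U \<Longrightarrow> x \<noteq> v \<Longrightarrow> E v x"
  shows "colorable U"
proof -
  have "valid_on U U (\<lambda>x. x = v)"
  proof (rule valid_onI)
    fix K x y assume K: "max_clique U K" and xy: "x \<in> K" "y \<in> K" "x \<noteq> y" and mono: "\<exists>b. \<forall>z\<in>K. (z = v) = b"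
    have "v \<in> K" using max_cliqueD(1,3)[OF K] assms by metis
    then show False using mono xy by metis
  qed
  then show ?thesis unfolding colorable_def by blast
qed

end

section \<open>Minimal counterexamples\<close>

text \<open>The assumptions describe a minimal counterexample and are refuted by
  \<open>inconsistent\<close>. Each use of \<open>proper_colorable\<close> must first exclude long
  odd components of \<open>W\<close>.\<close>

locale minimal_noncolorable = sparse_claw_free +
  fixes U :: "'a set"
  assumes U_V: "U \<subseteq> V"
    and not_colorable: "\<not> colorable U"
    and no_long_odd: "\<not> long_odd_component U D"
    and proper_colorable: "W \<subset> U \<Longrightarrow> (\<And>D. \<not> long_odd_component W D) \<Longrightarrow> colorable W"
begin

text \<open>A long odd component \<open>D\<close> of \<open>X\<close> is not closed in
  \<open>U\<close>, so one of its vertices has a neighbour in \<open>Y - X\<close>; that vertex can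
  only be \<open>v\<close>. This neighbour and the two nonadjacent neighbours of \<open>v\<close> on
  the cycle form a claw.\<close>

lemma part_colorable:
  assumes U: "U = X \<union> Y" "X \<noteq> U" and cut: "X \<inter> Y \<subseteq> {v}"
    and sep: "\<And>x y. x \<in> X - Y \<Longrightarrow> y \<in> Y - X \<Longrightarrow> \<not> E x y"
  shows "colorable X"
proof (rule proper_colorable)
  show "X \<subset> U" using U by blast
  fix D
  show "\<not> long_odd_component X D"
  proof
    assume D: "long_odd_component X D"
    then have DX: "closed_in X D" by (simp add: long_odd_component_def)
    have "\<not> closed_in U D" using D no_long_odd unfolding long_odd_component_def by blast
    then obtain x y where xy: "x \<in> D" "y \<in> U" "E x y" "y \<notin> D"
      using DX U unfolding closed_in_def by blast
    then have "x \<in> X" "y \<in> Y - X" using DX U unfolding closed_in_def by blast+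
    then have "x \<in> Y" using sep xy by blast
    then have "x = v" using cut \<open>x \<in> X\<close> by blast
    obtain p q where pq: "p \<noteq> q" "\<not> E p q" "nbhd X x = {p, q}"
      by (rule long_odd_component_nbhd[OF D xy(1)])
    then have "p \<in> X" "q \<in> X" "E x p" "E x q" by (auto simp: nbhd_def)
    then have "p \<in> X - Y" "q \<in> X - Y" using cut \<open>x = v\<close> E_irrefl by blast+
    then show False
      using claw[of x p q y] pq xy sep[of p y] sep[of q y] \<open>E x p\<close> \<open>E x q\<close> \<open>y \<in> Y - X\<close> by blast
  qed
qed

text \<open>If \<open>U - A\<close> fell apart, both sides, each with the cut vertex added, would be
  colourable and could be glued. Taking \<open>A\<close> empty or a singleton gives connectedness
  and the absence of cut vertices at once.\<close>

lemma linked_Diff: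
  assumes "A \<subseteq> {v}"
  shows "linked (U - A)"
  unfolding linked_def
proof (intro allI impI)
  fix Z assume Z: "closed_in (U - A) Z"
  show "Z = {} \<or> Z = U - A"
  proof (rule ccontr)
    assume ne: "\<not> (Z = {} \<or> Z = U - A)"
    define X where "X = Z \<union> (A \<inter> U)"
    define Y where "Y = U - Z"
    have ZU: "Z \<subseteq> U - A" using Z by (simp add: closed_in_def)
    have 1: "U = X \<union> Y" "X \<inter> Y \<subseteq> {v}" "X \<noteq> U" "Y \<noteq> U" using ZU ne assms by (auto simp: X_def Y_def)
    have 2: "\<not> E x y" if "x \<in> X - Y" "y \<in> Y - X" for x y
      using that Z ZU unfolding closed_in_def X_def Y_def by blast
    have "colorable X" using part_colorable[OF 1(1,3,2)] 2 by blast
    moreover have "colorable Y" using part_colorable[of Y X v] 1 2 E_sym by (metis inf_commute sup_commute)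
    ultimately show False using separated_colorable[OF 1(1,2)] 2 not_colorable by blast
  qed
qed

lemmas linked_Diff_single = linked_Diff[OF subset_refl]

lemma linked_U: "linked U"
  using linked_Diff[of "{}"] by simp

text \<open>As \<open>U - {v}\<close> is connected, a long odd component would be all of it and
  every vertex would have exactly two neighbours, nonadjacent; \<open>x\<close> is a witness against
  this.\<close>

lemma delete_colorable:
  assumes "v \<in> U" "x \<in> U - {v}"
    and "\<And>y z. y \<noteq> z \<Longrightarrow> \<not> E y z \<Longrightarrow> nbhd (U - {v}) x \<noteq> {y, z}"
  shows "colorable (U - {v})"
proof (rule proper_colorable)
  show "U - {v} \<subset> U" using assms by blast
  fix D
  show "\<not> long_odd_component (U - {v}) D"
  proof
    assume D: "long_odd_component (U - {v}) D"
    then obtain n f where "n > 3" "cycle_on E n f D" unfolding long_odd_component_def by blast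
    then have "D \<noteq> {}" by (auto simp: cycle_on_def bij_betw_def)
    then have "D = U - {v}"
      using D linked_Diff_single[of v] unfolding long_odd_component_def linked_def by blast
    then show False using long_odd_component_nbhd[OF D, of x] assms by metis
  qed
qed

text \<open>A maximal clique of \<open>U\<close> avoiding \<open>v\<close> stays maximal in
  \<open>U - {v}\<close>. A colouring of \<open>U - {v}\<close> is thus a valid partial colouring of
  \<open>U\<close>, and it cannot extend to \<open>v\<close>.\<close>

lemma delete_conflict:
  assumes "v \<in> U" "colorable (U - {v})"
  obtains c Q1 Q2 where "valid_on (U - {v}) (U - {v}) c"
    "max_clique (nbhd U v) Q1" "\<And>x. x \<in> Q1 \<Longrightarrow> c x"
    "max_clique (nbhd U v) Q2" "\<And>x. x \<in> Q2 \<Longrightarrow> \<not> c x"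
proof -
  obtain c where c: "valid_on (U - {v}) (U - {v}) c" using assms unfolding colorable_def by blast
  have "valid_on U (U - {v}) c"
  proof (rule valid_onI)
    fix K x y assume K: "max_clique U K" "K \<subseteq> U - {v}" "x \<in> K" "y \<in> K" "x \<noteq> y" "\<exists>b. \<forall>z\<in>K. c z = b"
    then have "max_clique (U - {v}) K" using max_clique_Diff by blast
    then show False using valid_onD[OF c _ K(2-5)] K(6) by blast
  qed
  then show ?thesis
  proof (rule valid_extend[of _ _ _ v])
    show "v \<in> U" "v \<notin> U - {v}" using assms by auto
  next
    fix c' assume "valid_on U (insert v (U - {v})) c'"
    then show ?thesis using not_colorable assms unfolding colorable_def by (simp add: insert_absorb)
  next
    fix Q1 Q2
    assume "max_clique (nbhd U v) Q1" "\<And>x. x \<in> Q1 \<Longrightarrow> c x" "max_clique (nbhd U v) Q2" "\<And>x. x \<in> Q2 \<Longrightarrow> \<not> c x"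
    then show ?thesis using that c by blast
  qed
qed

section \<open>Recolouring and exclusion of wheels\<close>

lemma max_clique_edge:
  assumes Q: "max_clique N Q" and N: "N \<noteq> {}" "\<forall>x\<in>N. \<exists>y\<in>N. E x y"
  obtains x y where "x \<in> Q" "y \<in> Q" "E x y"
proof -
  have "Q \<noteq> {}" using Q N(1) unfolding max_clique_def by blast
  then obtain x where x: "x \<in> Q" by blast
  then obtain y where y: "y \<in> N" "E x y" using N(2) max_cliqueD(1)[OF Q] by blast
  show ?thesis
  proof (cases "y \<in> Q")
    case True
    then show ?thesis using that x y by blast
  next
    case False
    then obtain z where "z \<in> Q" "\<not> E y z" using max_clique_nonadj[OF Q] y by blast
    then have "z \<noteq> x" using y E_sym by blast
    then show ?thesis using that x \<open>z \<in> Q\<close> max_cliqueD(2)[OF Q] by blast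
  qed
qed

text \<open>The new colouring \<open>c'\<close> must spoil some clique. By \<open>hub\<close> that
  clique avoids \<open>r\<close>, since otherwise the rest of it would contain an edge in the colour
  of \<open>r\<close>; since \<open>c\<close> was valid, it meets the recoloured set
  \<open>F\<close>.\<close>

lemma wheel_recolor:
  assumes r: "r \<in> U" and c: "valid_on (U - {r}) (U - {r}) c"
    and N: "nbhd U r \<noteq> {}" "\<forall>x\<in>nbhd U r. \<exists>y\<in>nbhd U r. E x y"
    and same: "\<forall>x. x \<notin> F \<and> x \<noteq> r \<longrightarrow> c' x = c x"
    and hub: "\<forall>x\<in>nbhd U r. \<forall>y\<in>nbhd U r. E x y \<and> c' x = c' r \<longrightarrow> c' y \<noteq> c' r"
  obtains K i where "max_clique U K" "r \<notin> K" "i \<in> K" "i \<in> F" "\<And>z. z \<in> K \<Longrightarrow> c' z = c' i"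
proof -
  obtain K x y where K: "max_clique U K" "x \<in> K" "y \<in> K" "x \<noteq> y" "\<exists>b. \<forall>z\<in>K. c' z = b"
    using not_colorable valid_onI[of U U c'] unfolding colorable_def by blast
  then obtain b where b: "\<And>z. z \<in> K \<Longrightarrow> c' z = b" by blast
  have "r \<notin> K"
  proof
    assume rK: "r \<in> K"
    have mc: "max_clique (nbhd U r) (K - {r})" by (rule max_clique_remove[OF K(1) rK])
    from max_clique_edge[OF mc N] obtain x' y' where "x' \<in> K - {r}" "y' \<in> K - {r}" "E x' y'"
      by blast
    then show False
      using hub b[of x'] b[of y'] b[OF rK] mc max_cliqueD(1) by (metis DiffD1)
  qed
  have KU: "K \<subseteq> U - {r}" using \<open>r \<notin> K\<close> max_cliqueD(1)[OF K(1)] by blast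
  obtain i where "i \<in> K" "i \<in> F"
  proof (rule ccontr)
    assume "\<not> thesis"
    then have "\<forall>z\<in>K. c z = b" using that same b \<open>r \<notin> K\<close> by metis
    then show False
      using valid_onD[OF c max_clique_Diff[OF K(1) \<open>r \<notin> K\<close>] KU K(2-4)] by blast
  qed
  then show ?thesis using that K(1) \<open>r \<notin> K\<close> b by metis
qed

text \<open>If the neighbourhood is closed, \<open>r\<close> is adjacent to everything else.
  Otherwise some neighbour of \<open>r\<close> has two neighbours inside the neighbourhood and a
  third outside, so \<open>U - {r}\<close> is no odd cycle.\<close>

lemma wheel_delete:
  assumes r: "r \<in> U" and N: "nbhd U r \<noteq> {}"
    and deg: "\<And>x. x \<in> nbhd U r \<Longrightarrow> \<exists>p\<in>nbhd U r. \<exists>q\<in>nbhd U r. p \<noteq> q \<and> E x p \<and> E x q"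
  shows "colorable (U - {r})"
proof (cases "closed_in (U - {r}) (nbhd U r)")
  case True
  then have "nbhd U r = U - {r}" using linked_Diff_single[of r] N unfolding linked_def by blast
  then have "colorable U" using universal_colorable[OF r] by (auto simp: nbhd_def)
  then show ?thesis using not_colorable by blast
next
  case False
  have "nbhd U r \<subseteq> U - {r}" using E_irrefl by (auto simp: nbhd_def)
  then obtain x y where xy: "x \<in> nbhd U r" "y \<in> U - {r}" "E x y" "y \<notin> nbhd U r"
    using False unfolding closed_in_def by blast
  obtain p q where pq: "p \<in> nbhd U r" "q \<in> nbhd U r" "p \<noteq> q" "E x p" "E x q" using deg[OF xy(1)] by blast
  show ?thesis
  proof (rule delete_colorable[OF r, of x])
    show "x \<in> U - {r}" using xy \<open>nbhd U r \<subseteq> U - {r}\<close> by blast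
    have "{p, q, y} \<subseteq> nbhd (U - {r}) x" "y \<noteq> p" "y \<noteq> q"
      using pq xy \<open>nbhd U r \<subseteq> U - {r}\<close> by (auto simp: in_nbhd)
    then show "nbhd (U - {r}) x \<noteq> {a, b}" for a b
      using pq(3) by (metis empty_iff insert_iff subset_iff)
  qed
qed

text \<open>Recolour \<open>i\<close> with \<open>b\<close> and give the hub the colour
  \<open>b'\<close>. The spoiled clique contains \<open>i\<close> but neither \<open>r\<close> nor
  \<open>p\<close>, so \<open>max_clique_fork\<close> puts all common neighbours of \<open>i\<close>
  and \<open>q\<close> except \<open>r\<close> into it.\<close>

lemma flip_blocked:
  assumes r: "r \<in> U" and c: "valid_on (U - {r}) (U - {r}) c"
    and N: "\<forall>x\<in>nbhd U r. \<exists>y\<in>nbhd U r. E x y"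
    and ipq: "i \<in> nbhd U r" "p \<in> nbhd U r" "q \<in> nbhd U r" "E i p" "E i q" "\<not> E p q" "p \<noteq> q"
    and only: "\<forall>z\<in>nbhd U r. E i z \<longrightarrow> z = p \<or> z = q"
    and cp: "c p \<noteq> b"
    and hub: "\<forall>x\<in>nbhd U r. \<forall>y\<in>nbhd U r. E x y \<and> (c(i := b)) x = b' \<longrightarrow> (c(i := b)) y \<noteq> b'"
  shows "{z \<in> U. E i z \<and> E q z \<and> z \<noteq> r} \<noteq> {}"
    and "z \<in> U \<Longrightarrow> E i z \<Longrightarrow> E q z \<Longrightarrow> z \<noteq> r \<Longrightarrow> c z = b"
proof -
  define c' where "c' = c(i := b, r := b')"
  have nr: "x \<noteq> r" if "x \<in> nbhd U r" for x using that E_irrefl by (auto simp: in_nbhd)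
  obtain K where K: "max_clique U K" "r \<notin> K" "i \<in> K" "\<And>z. z \<in> K \<Longrightarrow> c' z = c' i"
  proof (rule wheel_recolor[OF r c _ N, of "{i}" c'])
    show "nbhd U r \<noteq> {}" using ipq by blast
    show "\<forall>x. x \<notin> {i} \<and> x \<noteq> r \<longrightarrow> c' x = c x" by (simp add: c'_def)
    have "c' x = (c(i := b)) x" if "x \<in> nbhd U r" for x using nr[OF that] by (simp add: c'_def)
    moreover have "c' r = b'" by (simp add: c'_def)
    ultimately show "\<forall>x\<in>nbhd U r. \<forall>y\<in>nbhd U r. E x y \<and> c' x = c' r \<longrightarrow> c' y \<noteq> c' r"
      using hub by metis
  next
    fix K j
    assume "max_clique U K" "r \<notin> K" "j \<in> K" "j \<in> {i}" "\<And>z. z \<in> K \<Longrightarrow> c' z = c' j"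
    then show ?thesis using that by blast
  qed
  have ne: "i \<noteq> r" "p \<noteq> r" "p \<noteq> i" using nr ipq E_irrefl by blast+
  have "c' i = b" "c' p = c p" using ne by (auto simp: c'_def)
  then have "p \<notin> K" using K(4)[of p] cp by auto
  have inU: "i \<in> U" "p \<in> U" "q \<in> U" "E r i" "E r p" "E r q" using ipq by (auto simp: in_nbhd)
  note fork = max_clique_fork[OF inU(1) r inU(2-6) ipq(4-7) only K(1,3,2) \<open>p \<notin> K\<close>]
  show "{z \<in> U. E i z \<and> E q z \<and> z \<noteq> r} \<noteq> {}"
    by (rule fork(1))
  have sub: "{z \<in> U. E i z \<and> E q z \<and> z \<noteq> r} \<subseteq> K"
    by (rule fork(2))
  show "c z = b" if "z \<in> U" "E i z" "E q z" "z \<noteq> r"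
  proof -
    have "z \<in> K" "z \<noteq> i" using sub that E_irrefl by blast+
    then show ?thesis using K(4)[of z] that \<open>c' i = b\<close> by (auto simp: c'_def)
  qed
qed

text \<open>Flipping \<open>p1\<close> shows that \<open>p1\<close> and \<open>p4\<close> have
  common neighbours besides the hub, all of colour \<open>b\<close>; flipping \<open>p4\<close>
  shows that these have colour \<open>a\<close>.\<close>

lemma four_wheel_colors:
  assumes r: "r \<in> U" and c: "valid_on (U - {r}) (U - {r}) c"
    and N: "nbhd U r = {p1, p2, p3, p4}" "distinct [p1, p2, p3, p4]"
    and e: "E p1 p2" "E p2 p3" "E p3 p4" "E p4 p1" "\<not> E p1 p3" "\<not> E p2 p4"
    and col: "c p1 = a" "c p2 = a" "c p3 = b" "c p4 = b" "a \<noteq> b"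
  shows False
proof -
  have s: "E p2 p1" "E p3 p2" "E p4 p3" "E p1 p4" "\<not> E p3 p1" "\<not> E p4 p2" using e E_sym by blast+
  have deg: "\<forall>x\<in>nbhd U r. \<exists>y\<in>nbhd U r. E x y" using e s unfolding N by blast
  note blocked = flip_blocked[OF r c deg]
  have in_N: "p1 \<in> nbhd U r" "p2 \<in> nbhd U r" "p3 \<in> nbhd U r" "p4 \<in> nbhd U r" unfolding N by auto
  have ne: "p2 \<noteq> p4" "p3 \<noteq> p1" using N(2) by auto
  have only: "\<forall>z\<in>nbhd U r. E p1 z \<longrightarrow> z = p2 \<or> z = p4" "\<forall>z\<in>nbhd U r. E p4 z \<longrightarrow> z = p3 \<or> z = p1"
    using e s E_irrefl unfolding N by blast+
  have cb: "c p2 \<noteq> b" "c p3 \<noteq> a" using col by auto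
  \<comment> \<open>After the flip only \<open>p2\<close> keeps colour \<open>a\<close> on the rim,
    which frees \<open>a\<close> for the hub.\<close>
  have hub1: "\<forall>x\<in>nbhd U r. \<forall>y\<in>nbhd U r. E x y \<and> (c(p1 := b)) x = a \<longrightarrow> (c(p1 := b)) y \<noteq> a"
  proof -
    have "z = p2" if "z \<in> nbhd U r" "(c(p1 := b)) z = a" for z
      using that N(2) col unfolding N(1) by auto
    then show ?thesis using E_irrefl by blast
  qed
  have hub4: "\<forall>x\<in>nbhd U r. \<forall>y\<in>nbhd U r. E x y \<and> (c(p4 := a)) x = b \<longrightarrow> (c(p4 := a)) y \<noteq> b"
  proof -
    have "z = p3" if "z \<in> nbhd U r" "(c(p4 := a)) z = b" for z
      using that N(2) col unfolding N(1) by auto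
    then show ?thesis using E_irrefl by blast
  qed
  note flip1 = blocked[OF in_N(1,2,4) e(1) s(4) e(6) ne(1) only(1) cb(1) hub1]
  note flip4 = blocked[OF in_N(4,3,1) s(3) e(4) s(5) ne(2) only(2) cb(2) hub4]
  obtain z where z: "z \<in> U" "E p1 z" "E p4 z" "z \<noteq> r" using flip1(1) by blast
  then have "c z = b" "c z = a" using flip1(2)[of z] flip4(2)[of z] by blast+
  then show False using col by simp
qed

text \<open>Flipping \<open>p3\<close> or \<open>p4\<close> alone forces colour \<open>a\<close> on
  the common neighbours, except \<open>r\<close>, of \<open>p2\<close> and \<open>p3\<close> and of
  \<open>p4\<close> and \<open>p5\<close>. Flipping \<open>p2\<close> and \<open>p5\<close> together
  yields such a vertex of colour \<open>b\<close>.\<close>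

lemma five_wheel_colors:
  assumes r: "r \<in> U" and c: "valid_on (U - {r}) (U - {r}) c"
    and N: "nbhd U r = {p1, p2, p3, p4, p5}" "distinct [p1, p2, p3, p4, p5]"
    and e: "E p1 p2" "E p2 p3" "E p3 p4" "E p4 p5" "E p5 p1"
      "\<not> E p1 p3" "\<not> E p2 p4" "\<not> E p3 p5" "\<not> E p4 p1" "\<not> E p5 p2"
    and col: "c p5 = a" "c p1 = a" "c p2 = a" "c p3 = b" "c p4 = b" "a \<noteq> b"
  shows False
proof -
  have s: "E p2 p1" "E p3 p2" "E p4 p3" "E p5 p4" "E p1 p5"
    "\<not> E p3 p1" "\<not> E p4 p2" "\<not> E p5 p3" "\<not> E p1 p4" "\<not> E p2 p5" using e E_sym by blast+
  have deg: "\<forall>x\<in>nbhd U r. \<exists>y\<in>nbhd U r. E x y" using e s unfolding N by blast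
  note blocked = flip_blocked[OF r c deg]
  have in_N: "p1 \<in> nbhd U r" "p2 \<in> nbhd U r" "p3 \<in> nbhd U r" "p4 \<in> nbhd U r" "p5 \<in> nbhd U r"
    unfolding N by auto
  then have U: "p1 \<in> U" "p2 \<in> U" "p3 \<in> U" "p4 \<in> U" "p5 \<in> U"
    and rp: "E r p1" "E r p2" "E r p3" "E r p4" "E r p5" by (auto simp: in_nbhd)
  have ne: "p4 \<noteq> p2" "p3 \<noteq> p5" "p1 \<noteq> p3" "p1 \<noteq> p4" "p2 \<noteq> p5" "r \<noteq> p1" "r \<noteq> p2" "r \<noteq> p3" "r \<noteq> p4" "r \<noteq> p5"
    using N(2) rp E_irrefl by auto
  have only: "\<forall>z\<in>nbhd U r. E p3 z \<longrightarrow> z = p4 \<or> z = p2" "\<forall>z\<in>nbhd U r. E p4 z \<longrightarrow> z = p3 \<or> z = p5"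
    "\<forall>z\<in>nbhd U r. E p2 z \<longrightarrow> z = p1 \<or> z = p3" "\<forall>z\<in>nbhd U r. E p5 z \<longrightarrow> z = p1 \<or> z = p4"
    using e s E_irrefl unfolding N by blast+
  have cb: "c p4 \<noteq> a" "c p3 \<noteq> a" using col by auto
  have hub3: "\<forall>x\<in>nbhd U r. \<forall>y\<in>nbhd U r. E x y \<and> (c(p3 := a)) x = b \<longrightarrow> (c(p3 := a)) y \<noteq> b"
  proof -
    have "z = p4" if "z \<in> nbhd U r" "(c(p3 := a)) z = b" for z
      using that N(2) col unfolding N(1) by auto
    then show ?thesis using E_irrefl by blast
  qed
  have hub4: "\<forall>x\<in>nbhd U r. \<forall>y\<in>nbhd U r. E x y \<and> (c(p4 := a)) x = b \<longrightarrow> (c(p4 := a)) y \<noteq> b"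
  proof -
    have "z = p3" if "z \<in> nbhd U r" "(c(p4 := a)) z = b" for z
      using that N(2) col unfolding N(1) by auto
    then show ?thesis using E_irrefl by blast
  qed
  note flip3 = blocked(2)[OF in_N(3,4,2) e(3) s(2) s(7) ne(1) only(1) cb(1) hub3]
  note flip4 = blocked(2)[OF in_N(4,3,5) s(3) e(4) e(8) ne(2) only(2) cb(2) hub4]
  \<comment> \<open>Now \<open>p1\<close> is the only rim vertex of colour \<open>a\<close>, so the
    hub can take \<open>a\<close>.\<close>
  define c' where "c' = c(p2 := b, p5 := b, r := a)"
  have c': "c' p1 = a" "c' p2 = b" "c' p3 = b" "c' p4 = b" "c' p5 = b" "c' r = a"
    using ne N(2) col by (auto simp: c'_def)
  have hub: "\<forall>x\<in>nbhd U r. \<forall>y\<in>nbhd U r. E x y \<and> c' x = c' r \<longrightarrow> c' y \<noteq> c' r"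
  proof -
    have "z = p1" if "z \<in> nbhd U r" "c' z = c' r" for z
      using that c' col(6) unfolding N(1) by auto
    then show ?thesis using E_irrefl by blast
  qed
  have "nbhd U r \<noteq> {}" "\<forall>x. x \<notin> {p2, p5} \<and> x \<noteq> r \<longrightarrow> c' x = c x" using N by (auto simp: c'_def)
  from wheel_recolor[OF r c this(1) deg this(2) hub]
  obtain K i where K: "max_clique U K" "r \<notin> K" "i \<in> K" "i \<in> {p2, p5}" "\<And>z. z \<in> K \<Longrightarrow> c' z = c' i"
    by blast
  have ci: "c' i = b" using K(4) c' by auto
  then have "p1 \<notin> K" using K(5)[of p1] c' col by auto
  have *: "c z = b" if "z \<in> K" "z \<noteq> p2" "z \<noteq> p5" for z
  proof -
    have "z \<noteq> r" using that K(2) by blast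
    then show ?thesis using K(5)[OF that(1)] that ci by (simp add: c'_def)
  qed
  from K(4) consider "i = p2" | "i = p5" by blast
  then show False
  proof cases
    case 1
    then have "p2 \<in> K" using K(3) by simp
    note fork = max_clique_fork[OF U(2) r U(1,3) rp(2,1,3) s(1) e(2) e(6) ne(3) only(3) K(1) this K(2) \<open>p1 \<notin> K\<close>]
    obtain z where z: "z \<in> U" "E p2 z" "E p3 z" "z \<noteq> r" "z \<in> K"
      using fork(1,2) unfolding in_nbhd by blast
    have "z \<noteq> p2" "z \<noteq> p5" using z s E_irrefl by blast+
    then show False using *[of z] flip3[of z] z col by auto
  next
    case 2
    then have "p5 \<in> K" using K(3) by simp
    note fork = max_clique_fork[OF U(5) r U(1,4) rp(5,1,4) e(5) s(4) s(9) ne(4) only(4) K(1) this K(2) \<open>p1 \<notin> K\<close>]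
    obtain z where z: "z \<in> U" "E p5 z" "E p4 z" "z \<noteq> r" "z \<in> K"
      using fork(1,2) unfolding in_nbhd by blast
    have "z \<noteq> p2" "z \<noteq> p5" using z e E_irrefl by blast+
    then show False using *[of z] flip4[of z] z col by auto
  qed
qed

text \<open>By claws, a further neighbour \<open>x\<close> of \<open>r\<close> is adjacent to at
  least one vertex of each nonadjacent rim pair, and by \<open>K33\<close> not to both. The five
  pairs form a 5-cycle, so parity rules this out. The neighbourhood is therefore just the rim, where
  recolouring applies.\<close>

lemma no_induced_five_wheel:
  assumes r: "r \<in> U" and in_N: "{p1, p2, p3, p4, p5} \<subseteq> nbhd U r" and dist: "distinct [p1, p2, p3, p4, p5]"
    and e: "E p1 p2" "E p2 p3" "E p3 p4" "E p4 p5" "E p5 p1"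
      "\<not> E p1 p3" "\<not> E p2 p4" "\<not> E p3 p5" "\<not> E p4 p1" "\<not> E p5 p2"
  shows False
proof -
  have s: "E p2 p1" "E p3 p2" "E p4 p3" "E p5 p4" "E p1 p5"
    "\<not> E p3 p1" "\<not> E p4 p2" "\<not> E p5 p3" "\<not> E p1 p4" "\<not> E p2 p5" using e E_sym by blast+
  have rp: "E r p1" "E r p2" "E r p3" "E r p4" "E r p5" using in_N by (auto simp: in_nbhd)
  have pr: "E p1 r" "E p2 r" "E p3 r" "E p4 r" "E p5 r" using rp E_sym by blast+
  have "x \<in> {p1, p2, p3, p4, p5}" if "x \<in> nbhd U r" for x
  proof (rule ccontr)
    assume x: "x \<notin> {p1, p2, p3, p4, p5}"
    have rx: "E r x" "E x r" "x \<noteq> r" using that E_sym E_irrefl by (auto simp: in_nbhd)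
    have adj: "E x p1 \<or> E x p3" "E x p2 \<or> E x p4" "E x p3 \<or> E x p5" "E x p4 \<or> E x p1" "E x p5 \<or> E x p2"
      using claw[of r x p1 p3] claw[of r x p2 p4] claw[of r x p3 p5] claw[of r x p4 p1] claw[of r x p5 p2]
        rx rp x dist e by auto
    have two: "\<not> (E x a \<and> E x c)"
      if "E a b" "E b c" "E c d" "E d f" "E f a" "E r a" "E r b" "E r c" "E r d" "E r f"
        "distinct [a, b, c, d, f]" "x \<notin> {a, b, c, d, f}" for a b c d f
    proof
      assume xac: "E x a \<and> E x c"
      have "r \<notin> {a, b, c, d, f}" using that E_irrefl by blast
      \<comment> \<open>The branch sets are \<open>a\<close>, \<open>c\<close>, \<open>r\<close> on
        one side and \<open>b\<close>, \<open>x\<close>, \<open>{d, f}\<close> on the other.\<close>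
      then show False
        using K33[of a b c r x d f] that xac rx E_sym E_irrefl by auto
    qed
    have "\<not> (E x p1 \<and> E x p3)" "\<not> (E x p2 \<and> E x p4)" "\<not> (E x p3 \<and> E x p5)"
      "\<not> (E x p4 \<and> E x p1)" "\<not> (E x p5 \<and> E x p2)"
      using two[of p1 p2 p3 p4 p5] two[of p2 p3 p4 p5 p1] two[of p3 p4 p5 p1 p2]
        two[of p4 p5 p1 p2 p3] two[of p5 p1 p2 p3 p4] e(1-5) rp dist x by auto
    then show False using adj by blast
  qed
  then have N: "nbhd U r = {p1, p2, p3, p4, p5}" using in_N by blast
  have N2: "\<exists>p\<in>nbhd U r. \<exists>q\<in>nbhd U r. p \<noteq> q \<and> E x p \<and> E x q" if "x \<in> nbhd U r" for x
    using that e s dist unfolding N by auto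
  have N1: "nbhd U r \<noteq> {}" "\<forall>x\<in>nbhd U r. \<exists>y\<in>nbhd U r. E x y"
    using in_N N2 by blast+
  have "colorable (U - {r})" by (rule wheel_delete[OF r N1(1) N2])
  from delete_conflict[OF r this] obtain c Q1 Q2 where c: "valid_on (U - {r}) (U - {r}) c"
    and Q1: "max_clique (nbhd U r) Q1" "\<And>x. x \<in> Q1 \<Longrightarrow> c x"
    and Q2: "max_clique (nbhd U r) Q2" "\<And>x. x \<in> Q2 \<Longrightarrow> \<not> c x" by blast
  obtain x y where "x \<in> Q1" "y \<in> Q1" "E x y" by (rule max_clique_edge[OF Q1(1) N1])
  then have T: "x \<in> nbhd U r" "y \<in> nbhd U r" "c x" "c y" "E x y" using Q1 max_cliqueD(1) by blast+
  obtain z w where "z \<in> Q2" "w \<in> Q2" "E z w" by (rule max_clique_edge[OF Q2(1) N1])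
  then have F: "z \<in> nbhd U r" "w \<in> nbhd U r" "\<not> c z" "\<not> c w" "E z w" using Q2 max_cliqueD(1) by blast+
  have T': "c p1 \<and> c p2 \<or> c p2 \<and> c p3 \<or> c p3 \<and> c p4 \<or> c p4 \<and> c p5 \<or> c p5 \<and> c p1"
    using T e s E_irrefl unfolding N by blast
  have F': "\<not> c p1 \<and> \<not> c p2 \<or> \<not> c p2 \<and> \<not> c p3 \<or> \<not> c p3 \<and> \<not> c p4 \<or> \<not> c p4 \<and> \<not> c p5 \<or> \<not> c p5 \<and> \<not> c p1"
    using F e s E_irrefl unfolding N by blast
  \<comment> \<open>With a monochromatic rim edge in each colour, three consecutive rim vertices
    have one colour and the other two the opposite one. The five rotations exhaust the
    positions.\<close>
  have rot: "\<not> (c s5 = c s1 \<and> c s1 = c s2 \<and> c s2 \<noteq> c s3 \<and> c s3 = c s4)"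
    if "nbhd U r = {s1, s2, s3, s4, s5}" "distinct [s1, s2, s3, s4, s5]"
      "E s1 s2" "E s2 s3" "E s3 s4" "E s4 s5" "E s5 s1"
      "\<not> E s1 s3" "\<not> E s2 s4" "\<not> E s3 s5" "\<not> E s4 s1" "\<not> E s5 s2" for s1 s2 s3 s4 s5
    using five_wheel_colors[OF r c that, of "c s1" "c s3"] by metis
  have "\<not> (c p5 = c p1 \<and> c p1 = c p2 \<and> c p2 \<noteq> c p3 \<and> c p3 = c p4)"
    by (rule rot) (use N dist e in auto)
  moreover have "\<not> (c p1 = c p2 \<and> c p2 = c p3 \<and> c p3 \<noteq> c p4 \<and> c p4 = c p5)"
    by (rule rot) (use N dist e in auto)
  moreover have "\<not> (c p2 = c p3 \<and> c p3 = c p4 \<and> c p4 \<noteq> c p5 \<and> c p5 = c p1)"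
    by (rule rot) (use N dist e in auto)
  moreover have "\<not> (c p3 = c p4 \<and> c p4 = c p5 \<and> c p5 \<noteq> c p1 \<and> c p1 = c p2)"
    by (rule rot) (use N dist e in auto)
  moreover have "\<not> (c p4 = c p5 \<and> c p5 = c p1 \<and> c p1 \<noteq> c p2 \<and> c p2 = c p3)"
    by (rule rot) (use N dist e in auto)
  ultimately show False using T' F' by argo
qed

text \<open>The cliques blocking the hub contain a rim edge in each colour, so two opposite rim
  edges are monochromatic in different colours. There are two choices of opposite edges.\<close>

lemma no_four_wheel:
  assumes r: "r \<in> U" and N: "nbhd U r = {p1, p2, p3, p4}" and dist: "distinct [p1, p2, p3, p4]"
    and e: "E p1 p2" "E p2 p3" "E p3 p4" "E p4 p1" "\<not> E p1 p3" "\<not> E p2 p4"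
  shows False
proof -
  have s: "E p2 p1" "E p3 p2" "E p4 p3" "E p1 p4" "\<not> E p3 p1" "\<not> E p4 p2" using e E_sym by blast+
  have N2: "\<exists>p\<in>nbhd U r. \<exists>q\<in>nbhd U r. p \<noteq> q \<and> E x p \<and> E x q" if "x \<in> nbhd U r" for x
    using that e s dist unfolding N by auto
  have N1: "nbhd U r \<noteq> {}" "\<forall>x\<in>nbhd U r. \<exists>y\<in>nbhd U r. E x y"
    using N N2 by blast+
  have "colorable (U - {r})" by (rule wheel_delete[OF r N1(1) N2])
  from delete_conflict[OF r this] obtain c Q1 Q2 where c: "valid_on (U - {r}) (U - {r}) c"
    and Q1: "max_clique (nbhd U r) Q1" "\<And>x. x \<in> Q1 \<Longrightarrow> c x"
    and Q2: "max_clique (nbhd U r) Q2" "\<And>x. x \<in> Q2 \<Longrightarrow> \<not> c x" by blast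
  obtain x y where "x \<in> Q1" "y \<in> Q1" "E x y" by (rule max_clique_edge[OF Q1(1) N1])
  then have T: "x \<in> nbhd U r" "y \<in> nbhd U r" "c x" "c y" "E x y" using Q1 max_cliqueD(1) by blast+
  obtain z w where "z \<in> Q2" "w \<in> Q2" "E z w" by (rule max_clique_edge[OF Q2(1) N1])
  then have F: "z \<in> nbhd U r" "w \<in> nbhd U r" "\<not> c z" "\<not> c w" "E z w" using Q2 max_cliqueD(1) by blast+
  have T': "c p1 \<and> c p2 \<or> c p2 \<and> c p3 \<or> c p3 \<and> c p4 \<or> c p4 \<and> c p1"
    using T e s E_irrefl unfolding N by blast
  have F': "\<not> c p1 \<and> \<not> c p2 \<or> \<not> c p2 \<and> \<not> c p3 \<or> \<not> c p3 \<and> \<not> c p4 \<or> \<not> c p4 \<and> \<not> c p1"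
    using F e s E_irrefl unfolding N by blast
  have "\<not> (c p1 = c p2 \<and> c p3 = c p4 \<and> c p1 \<noteq> c p3)"
    using four_wheel_colors[OF r c N dist e, of "c p1" "c p3"] by metis
  moreover have "\<not> (c p2 = c p3 \<and> c p4 = c p1 \<and> c p2 \<noteq> c p4)"
    using four_wheel_colors[OF r c _ _ e(2-4,1,6) s(5), of "c p2" "c p4"] N dist by auto
  ultimately show False using T' F' by argo
qed

text \<open>Delete \<open>x\<close>: since \<open>{r, b1, b2}\<close> is a maximal clique of \<open>U - {x}\<close>, it is not
  monochromatic there, so neither of the two cliques blocking \<open>x\<close> contains \<open>r\<close>.\<close>

lemma no_four_wheel_with_ear:
  assumes r: "r \<in> U" and in_N: "{a1, a2, b1, b2, x} \<subseteq> nbhd U r" and dist: "distinct [a1, a2, b1, b2, x]"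
    and e: "E a1 a2" "E b1 b2" "E a1 b1" "E a2 b2" "\<not> E a1 b2" "\<not> E a2 b1"
    and x: "E x b1" "E x b2" "\<not> E x a1" "\<not> E x a2"
  shows False
proof -
  have U: "a1 \<in> U" "a2 \<in> U" "b1 \<in> U" "b2 \<in> U" "x \<in> U" using in_N by (auto simp: in_nbhd)
  have ra: "E r a1" "E r a2" "E r b1" "E r b2" "E r x" using in_N by (auto simp: in_nbhd)
  have s: "E a1 r" "E a2 r" "E b1 r" "E b2 r" "E x r" "E a2 a1" "E b2 b1" "E b1 a1" "E b2 a2"
    "E b1 x" "E b2 x" "\<not> E b2 a1" "\<not> E b1 a2" "\<not> E a1 x" "\<not> E a2 x"
    using ra e x E_sym by blast+
  have nr: "r \<noteq> a1" "r \<noteq> a2" "r \<noteq> b1" "r \<noteq> b2" "r \<noteq> x" using ra E_irrefl by blast+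
  note simps = ra s e x nr E_irrefl
  \<comment> \<open>Otherwise \<open>{a1, b2, r}\<close> and \<open>{a2, b1, y}\<close> contradict
    \<open>K33\<close>.\<close>
  have antip: "\<not> E y a1" if "E r y" "y \<notin> {a1, a2, b1, b2}" "E y b2" for y
  proof
    assume "E y a1"
    have "E y r" "E b2 y" "E a1 y" using that \<open>E y a1\<close> E_sym by blast+
    moreover have "y \<noteq> r" using that E_irrefl by blast
    ultimately show False using K33[of a1 a2 b2 r b1 y y] that simps dist by auto
  qed
  \<comment> \<open>If \<open>y\<close> is adjacent to \<open>a1\<close> or \<open>a2\<close>, the
    contracted edge joins \<open>x\<close> and \<open>y\<close>. Otherwise claws at \<open>r\<close>
    make \<open>y\<close> adjacent to \<open>b1\<close> and \<open>b2\<close>, and the contracted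
    edge joins \<open>a1\<close> and \<open>a2\<close>.\<close>
  have common: "y = b1 \<or> y = b2" if y: "y \<in> nbhd U r" "E x y" for y
  proof (rule ccontr)
    assume ny: "\<not> (y = b1 \<or> y = b2)"
    have ry: "E r y" "y \<noteq> r" "E y r" "E y x" "y \<noteq> x" "y \<noteq> a1" "y \<noteq> a2"
      using y E_sym simps by (auto simp: in_nbhd)
    consider "E y a1" | "E y a2" | "\<not> E y a1" "\<not> E y a2" by blast
    then show False
    proof cases
      case 1
      then have "E a1 y" using E_sym by blast
      then show False using K33[of a1 a2 b2 r b1 x y] y ry simps dist ny by auto
    next
      case 2
      then have "E a2 y" using E_sym by blast
      then show False using K33[of a2 a1 b1 r b2 x y] y ry simps dist ny by auto
    next
      case 3
      have "E y b2" using claw[of r y a1 b2] simps ry 3 ny dist by auto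
      moreover have "E y b1" using claw[of r y a2 b1] simps ry 3 ny dist by auto
      ultimately have "E b1 y" "E b2 y" using E_sym by blast+
      then show False using K33[of b1 x b2 r y a1 a2] ry simps dist ny by auto
    qed
  qed
  have "colorable (U - {x})"
  proof (rule delete_colorable[OF U(5), of b1])
    show "b1 \<in> U - {x}" using U dist by auto
    have "{r, b2, a1} \<subseteq> nbhd (U - {x}) b1" using r U simps dist by (auto simp: in_nbhd)
    then show "nbhd (U - {x}) b1 \<noteq> {y, z}" for y z
      using nr dist by (metis distinct_length_2_or_more empty_iff insert_iff subset_iff)
  qed
  from delete_conflict[OF U(5) this] obtain c Q1 Q2 where c: "valid_on (U - {x}) (U - {x}) c"
    and Q1: "max_clique (nbhd U x) Q1" "\<And>x. x \<in> Q1 \<Longrightarrow> c x"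
    and Q2: "max_clique (nbhd U x) Q2" "\<And>x. x \<in> Q2 \<Longrightarrow> \<not> c x" by blast
  have disj: "Q1 \<inter> Q2 = {}" using Q1(2) Q2(2) by blast
  have mc: "max_clique (U - {x}) {r, b1, b2}"
    unfolding max_clique_def
  proof (intro conjI ballI)
    show "{r, b1, b2} \<subseteq> U - {x}" using r U nr dist by auto
    show "u \<noteq> v \<longrightarrow> E u v" if "u \<in> {r, b1, b2}" "v \<in> {r, b1, b2}" for u v using that simps by auto
    fix y assume y: "y \<in> U - {x} - {r, b1, b2}"
    show "\<exists>z\<in>{r, b1, b2}. \<not> E y z"
    proof (rule ccontr)
      assume "\<not> ?thesis"
      then have yr: "E r y" "E y b1" "E y b2" using E_sym by blast+
      then have yN: "y \<in> nbhd U r" using y by (auto simp: in_nbhd)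
      then have "\<not> E x y" using common y by blast
      moreover have "y \<noteq> a1" "y \<noteq> a2" using yr s(12,13) E_sym by blast+
      moreover from this have "\<not> E y a1" using antip[of y] yr y by blast
      ultimately show False using claw[of r x y a1] yr simps y dist by auto
    qed
  qed
  have hub: "r \<notin> Q" if Q: "max_clique (nbhd U x) Q" and mono: "\<And>z. z \<in> Q \<Longrightarrow> c z = b" for Q b
  proof
    assume "r \<in> Q"
    have "z \<in> {r, b1, b2}" if "z \<in> Q" for z
      using max_cliqueD(1)[OF Q that] max_cliqueD(2)[OF Q \<open>r \<in> Q\<close> that] common[of z]
      by (auto simp: in_nbhd)
    then have "Q \<subseteq> {r, b1, b2}" by blast
    moreover have "{r, b1, b2} \<subseteq> Q"
    proof
      fix z assume z: "z \<in> {r, b1, b2}"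
      show "z \<in> Q"
      proof (rule max_cliqueD(3)[OF Q])
        show "z \<in> nbhd U x" using z r U simps by (auto simp: in_nbhd)
        show "E z y" if "y \<in> Q" "z \<noteq> y" for y
        proof -
          have "y \<in> {r, b1, b2}" using that \<open>Q \<subseteq> {r, b1, b2}\<close> by blast
          then show ?thesis using that(2) z ra(3,4) s(3,4,7) e(2) by auto
        qed
      qed
    qed
    ultimately have "Q = {r, b1, b2}" by blast
    then have "\<forall>z\<in>{r, b1, b2}. c z = b" using mono by blast
    moreover have "{r, b1, b2} \<subseteq> U - {x}" using max_cliqueD(1)[OF mc] by blast
    ultimately show False using valid_onD[OF c mc _ _ _ nr(3)] by blast
  qed
  have rx: "r \<in> nbhd U x" using r simps by (auto simp: in_nbhd)
  have "r \<notin> Q1" by (rule hub[OF Q1(1), of True]) (use Q1(2) in simp)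
  have "r \<notin> Q2" by (rule hub[OF Q2(1), of False]) (use Q2(2) in simp)
  obtain p where p: "p \<in> Q1" "\<not> E r p" "r \<noteq> p" by (rule max_clique_nonadj[OF Q1(1) rx \<open>r \<notin> Q1\<close>])
  obtain q where q: "q \<in> Q2" "\<not> E r q" "r \<noteq> q" by (rule max_clique_nonadj[OF Q2(1) rx \<open>r \<notin> Q2\<close>])
  have NQ: "z \<in> nbhd U x" if "z \<in> Q1 \<union> Q2" for z
    using that max_cliqueD(1)[OF Q1(1)] max_cliqueD(1)[OF Q2(1)] by blast
  have "p \<notin> Q2" "q \<notin> Q1" using p q disj by blast+
  \<comment> \<open>\<open>s'\<close> and \<open>t\<close> are nonneighbours of \<open>p\<close> and
    \<open>q\<close> in the opposite cliques. Claws at \<open>x\<close> make both adjacent to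
    \<open>r\<close>, so by \<open>common\<close> they are \<open>b1\<close> and \<open>b2\<close>
    in some order.\<close>
  obtain s' where s': "s' \<in> Q2" "\<not> E p s'" "p \<noteq> s'"
    using max_clique_nonadj[OF Q2(1) NQ[of p] \<open>p \<notin> Q2\<close>] p by blast
  obtain t where t: "t \<in> Q1" "\<not> E q t" "q \<noteq> t"
    using max_clique_nonadj[OF Q1(1) NQ[of q] \<open>q \<notin> Q1\<close>] q by blast
  have nrQ: "z \<noteq> r" if "z \<in> Q1 \<union> Q2" for z using that \<open>r \<notin> Q1\<close> \<open>r \<notin> Q2\<close> by blast
  have "E r s'"
    by (rule nbhd_claw[of p U x]) (use NQ nrQ rx p s' E_sym in blast)+
  then have s'b: "s' = b1 \<or> s' = b2" using common[of s'] NQ[of s'] s' by (auto simp: in_nbhd)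
  have "E r t"
    by (rule nbhd_claw[of q U x]) (use NQ nrQ rx q t E_sym in blast)+
  then have tb: "t = b1 \<or> t = b2" using common[of t] NQ[of t] t by (auto simp: in_nbhd)
  have "s' \<noteq> t" using s' t disj by blast
  have xp: "E x p" "E p x" using NQ[of p] p E_sym by (auto simp: in_nbhd)
  have "p \<noteq> t" using \<open>E r t\<close> p by blast
  then have pt: "E p t" "E t p" using max_cliqueD(2)[OF Q1(1)] p t by blast+
  have pne: "p \<noteq> a1" "p \<noteq> a2" "p \<noteq> b1" "p \<noteq> b2" "p \<noteq> x" using p(2) ra by blast+
  from s'b tb \<open>s' \<noteq> t\<close> consider "s' = b2" "t = b1" | "s' = b1" "t = b2" by blast
  then show False
  proof cases
    case 1
    \<comment> \<open>With this edge, \<open>r\<close>, \<open>p\<close>, \<open>b2\<close> and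
      \<open>b1\<close>, \<open>x\<close>, \<open>{a1, a2}\<close> are the branch sets. The other
      case is symmetric.\<close>
    have "E a1 p" using claw[of b1 a1 p b2] 1 pt s' s e pne dist by auto
    then have "E p a1" using E_sym by blast
    then show False using K33[of r b1 p b2 x a1 a2] 1 pt xp simps pne p dist by auto
  next
    case 2
    have "E a2 p" using claw[of b2 a2 p b1] 2 pt s' s e pne dist by auto
    then have "E p a2" using E_sym by blast
    then show False using K33[of r b2 p b1 x a2 a1] 2 pt xp simps pne p dist by auto
  qed
qed

text \<open>A further neighbour of \<open>r\<close> is adjacent to at least one vertex of each
  opposite rim pair, by claws, and not to both, by \<open>K33\<close>. It is therefore an ear over a
  rim edge.\<close>

lemma no_induced_four_wheel:
  assumes r: "r \<in> U" and in_N: "{p1, p2, p3, p4} \<subseteq> nbhd U r" and dist: "distinct [p1, p2, p3, p4]"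
    and e: "E p1 p2" "E p2 p3" "E p3 p4" "E p4 p1" "\<not> E p1 p3" "\<not> E p2 p4"
  shows False
proof (cases "nbhd U r = {p1, p2, p3, p4}")
  case True
  then show ?thesis using no_four_wheel[OF r _ dist e] by blast
next
  case False
  then obtain x where x: "x \<in> nbhd U r" "x \<notin> {p1, p2, p3, p4}" using in_N by blast
  have s: "E p2 p1" "E p3 p2" "E p4 p3" "E p1 p4" "\<not> E p3 p1" "\<not> E p4 p2" using e E_sym by blast+
  have rp: "E r p1" "E r p2" "E r p3" "E r p4" "E r x" using in_N x by (auto simp: in_nbhd)
  then have pr: "E p1 r" "E p2 r" "E p3 r" "E p4 r" "E x r" using E_sym by blast+
  have nr: "r \<notin> {p1, p2, p3, p4, x}" using rp E_irrefl by blast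
  have c: "E x p1 \<or> E x p3" "E x p2 \<or> E x p4"
    using claw[of r x p1 p3] claw[of r x p2 p4] rp x e dist by auto
  have n13: "\<not> (E x p1 \<and> E x p3)"
  proof
    assume a: "E x p1 \<and> E x p3"
    then have "E p1 x" "E p3 x" using E_sym by blast+
    then show False using K33[of p1 p2 p3 r p4 x x] a e s rp pr nr x dist by auto
  qed
  have n24: "\<not> (E x p2 \<and> E x p4)"
  proof
    assume a: "E x p2 \<and> E x p4"
    then have "E p2 x" "E p4 x" using E_sym by blast+
    then show False using K33[of p2 p1 p4 r p3 x x] a e s rp pr nr x dist by auto
  qed
  consider "E x p1" "E x p2" "\<not> E x p3" "\<not> E x p4" | "E x p2" "E x p3" "\<not> E x p1" "\<not> E x p4"
    | "E x p3" "E x p4" "\<not> E x p1" "\<not> E x p2" | "E x p4" "E x p1" "\<not> E x p2" "\<not> E x p3"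
    using c n13 n24 by blast
  then show False
  proof cases
    case 1
    then show False using no_four_wheel_with_ear[OF r, of p4 p3 p1 p2 x] in_N x dist e s by auto
  next
    case 2
    then show False using no_four_wheel_with_ear[OF r, of p1 p4 p2 p3 x] in_N x dist e s by auto
  next
    case 3
    then show False using no_four_wheel_with_ear[OF r, of p2 p1 p3 p4 x] in_N x dist e s by auto
  next
    case 4
    then show False using no_four_wheel_with_ear[OF r, of p3 p2 p4 p1 x] in_N x dist e s by auto
  qed
qed

lemma tame_U: "tame U"
  unfolding tame_def
proof (intro conjI allI impI notI)
  fix v a b c d
  assume "v \<in> U \<and> {a, b, c, d} \<subseteq> nbhd U v \<and> distinct [a, b, c, d]"
    "E a b \<and> E b c \<and> E c d \<and> E d a \<and> \<not> E a c \<and> \<not> E b d"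
  then show False using no_induced_four_wheel[of v a b c d] by blast
next
  fix v a b c d f
  assume "v \<in> U \<and> {a, b, c, d, f} \<subseteq> nbhd U v \<and> distinct [a, b, c, d, f]"
    "E a b \<and> E b c \<and> E c d \<and> E d f \<and> E f a \<and> \<not> E a c \<and> \<not> E b d \<and> \<not> E c f \<and> \<not> E d a \<and> \<not> E f b"
  then show False using no_induced_five_wheel[of v a b c d f] by blast
qed

section \<open>Precoloured pairs and two-vertex cuts\<close>

lemma finite_U: "finite U"
  using finite_V U_V by (rule rev_finite_subset)

text \<open>Without a disjoint pair \<open>v\<close> is never blocked, and greedy colouring by
  descending distance from \<open>v\<close> would colour \<open>U\<close>.\<close>

lemma conflicting_cliques:
  assumes "v \<in> U"
  obtains Q1 Q2 where "max_clique (nbhd U v) Q1" "max_clique (nbhd U v) Q2" "Q1 \<inter> Q2 = {}"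
proof (rule ccontr)
  assume none: "\<not> thesis"
  then have safe: "safe U {} c v" for c using that unfolding safe_def by blast
  obtain d :: "'a \<Rightarrow> nat" where d: "\<And>u. u \<in> U \<Longrightarrow> u \<noteq> v \<Longrightarrow> \<exists>w\<in>U. E u w \<and> d w < d u"
    using linked_rank[OF linked_U assms] by blast
  have "colorable U"
    by (rule greedy_colorable[OF tame_U finite_U, of "{}" "\<lambda>_. True" d])
      (use safe d in \<open>auto simp: valid_on_def\<close>)
  then show False using not_colorable by blast
qed

text \<open>If \<open>a\<close> and \<open>b\<close> receive different colours, such a
  \<open>v\<close> cannot be blocked. Since all ordered pairs are considered, calling the clique of
  \<open>a\<close> the first one loses nothing.\<close>

definition anchored :: "'a \<Rightarrow> 'a \<Rightarrow> 'a \<Rightarrow> bool" where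
  "anchored a b v \<longleftrightarrow> a \<in> nbhd U v \<and>
    (\<forall>Q1 Q2. max_clique (nbhd U v) Q1 \<and> max_clique (nbhd U v) Q2 \<and> Q1 \<inter> Q2 = {} \<and> a \<in> Q1 \<longrightarrow> b \<in> Q1)"

text \<open>Give \<open>a\<close> and \<open>b\<close> different colours at the start and colour
  greedily. Several anchored roots are allowed at once, which serves the case that
  \<open>U - {a, b}\<close> is disconnected.\<close>

lemma no_anchored_ranking:
  fixes d :: "'a \<Rightarrow> nat"
  assumes ab: "a \<in> U" "b \<in> U" "a \<noteq> b"
    and root: "\<And>v. v \<in> U - {a, b} \<Longrightarrow> anchored a b v \<or> (\<exists>w\<in>U - {a, b}. E v w \<and> d w < d v)"
  shows False
proof -
  have "safe U {a, b} (\<lambda>x. x = a) v" if v: "v \<in> U" "anchored a b v" for v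
    unfolding safe_def
  proof (intro allI impI)
    fix Q1 Q2
    assume Q: "max_clique (nbhd U v) Q1 \<and> max_clique (nbhd U v) Q2 \<and> Q1 \<inter> Q2 = {}"
    then have "nbhd U v \<subseteq> Q1 \<union> Q2" using max_cliques_cover[OF tame_U v(1)] by blast
    then have "a \<in> Q1 \<or> a \<in> Q2" using v(2) unfolding anchored_def by blast
    then have "a \<in> Q1 \<and> b \<in> Q1 \<or> a \<in> Q2 \<and> b \<in> Q2"
      using v(2) Q unfolding anchored_def by (metis inf_commute)
    then show "\<exists>x\<in>{a, b}. \<exists>y\<in>{a, b}. (x = a) \<noteq> (y = a) \<and> (x \<in> Q1 \<and> y \<in> Q1 \<or> x \<in> Q2 \<and> y \<in> Q2)"
      using ab(3) by auto
  qed
  moreover have "valid_on U {a, b} (\<lambda>x. x = a)"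
    by (rule valid_onI) (use ab(3) in blast)
  ultimately have "colorable U"
    using greedy_colorable[OF tame_U finite_U, of "{a, b}" "\<lambda>x. x = a" d] ab root by blast
  then show False using not_colorable by blast
qed

lemma no_anchored_linked:
  assumes "a \<in> U" "b \<in> U" "a \<noteq> b" "r \<in> U - {a, b}" "anchored a b r" "linked (U - {a, b})"
  shows False
proof -
  obtain d :: "'a \<Rightarrow> nat" where
    "\<And>u. u \<in> U - {a, b} \<Longrightarrow> u \<noteq> r \<Longrightarrow> \<exists>w\<in>U - {a, b}. E u w \<and> d w < d u"
    using linked_rank[OF assms(6,4)] by blast
  then show False using no_anchored_ranking[OF assms(1-3), of d] assms(5) by blast
qed

text \<open>Otherwise \<open>Z\<close> would be closed in the connected set \<open>U - {b}\<close>
  and hence contain \<open>a\<close>.\<close>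

lemma closed_touches:
  assumes Z: "closed_in (U - {a, b}) Z" "Z \<noteq> {}" and ab: "a \<in> U" "a \<noteq> b"
  obtains z where "z \<in> Z" "E a z"
proof (rule ccontr)
  assume "\<not> thesis"
  then have none: "\<not> E z a" if "z \<in> Z" for z using that E_sym \<open>\<And>z. z \<in> Z \<Longrightarrow> E a z \<Longrightarrow> thesis\<close> by blast
  then have "closed_in (U - {b}) Z" using Z unfolding closed_in_def by blast
  then have "Z = U - {b}" using linked_Diff_single[of b] Z unfolding linked_def by blast
  then show False using Z ab unfolding closed_in_def by blast
qed

text \<open>If \<open>X\<close> split further, \<open>a\<close> would have neighbours in both pieces
  and in \<open>Y\<close>, a claw.\<close>

lemma cut_side_linked:
  assumes X: "closed_in (U - {a, b}) X" and Y: "closed_in (U - {a, b}) Y" "Y \<noteq> {}" "X \<inter> Y = {}"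
    and ab: "a \<in> U" "a \<noteq> b"
  shows "linked X"
  unfolding linked_def
proof (intro allI impI)
  fix Z assume Z: "closed_in X Z"
  show "Z = {} \<or> Z = X"
  proof (rule ccontr)
    assume ne: "\<not> (Z = {} \<or> Z = X)"
    have Z1: "closed_in (U - {a, b}) Z" using Z X unfolding closed_in_def by blast
    have Z2: "closed_in (U - {a, b}) (X - Z)" using closed_in_Diff[OF Z] X unfolding closed_in_def by blast
    have "X - Z \<noteq> {}" using Z ne unfolding closed_in_def by blast
    obtain z where z: "z \<in> Z" "E a z" using closed_touches[OF Z1 _ ab] ne by blast
    obtain w where w: "w \<in> X - Z" "E a w" using closed_touches[OF Z2 \<open>X - Z \<noteq> {}\<close> ab] by blast
    obtain y where y: "y \<in> Y" "E a y" using closed_touches[OF Y(1,2) ab] by blast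
    have XZ: "Z \<subseteq> X" "Z \<subseteq> U - {a, b}" "X \<subseteq> U - {a, b}" "Y \<subseteq> U - {a, b}" using Z Z1 X Y unfolding closed_in_def by blast+
    have "\<not> E z w" using z w Z unfolding closed_in_def by blast
    moreover have "\<not> E z y" using z y X XZ Y(3) unfolding closed_in_def by blast
    moreover have "\<not> E w y" using w y X XZ Y(3) unfolding closed_in_def by blast
    moreover have "z \<noteq> w" "z \<noteq> y" "w \<noteq> y" using z w y XZ Y(3) by blast+
    ultimately show False using claw[of a z w y] z w y by blast
  qed
qed

text \<open>Here \<open>b\<close> becomes the root and \<open>a\<close>, \<open>r\<close> are
  precoloured. If a pair at \<open>b\<close> separated \<open>a\<close> from \<open>r\<close>, the
  clique of \<open>r\<close> would contain a nonneighbour of \<open>a\<close>: not in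
  \<open>X\<close>, by \<open>twins\<close>, and not in \<open>Y\<close>, which has no edge to
  \<open>r\<close>.\<close>

lemma no_twin_cut:
  assumes X: "closed_in (U - {a, b}) X" and Y: "closed_in (U - {a, b}) Y" "Y \<noteq> {}" "X \<inter> Y = {}" "X \<union> Y = U - {a, b}"
    and ab: "a \<in> U" "b \<in> U" "E a b" and r: "r \<in> X" "E r b"
    and twins: "\<And>x. x \<in> X \<Longrightarrow> E a x \<longleftrightarrow> E b x"
  shows False
proof -
  have ne: "a \<noteq> b" using ab E_irrefl by blast
  have rU: "r \<in> U" "r \<noteq> a" "r \<noteq> b" using X r unfolding closed_in_def by blast+
  have "E b r" "E b a" using r ab E_sym by blast+
  have anch: "anchored a r b"
    unfolding anchored_def
  proof (intro conjI allI impI)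
    show "a \<in> nbhd U b" using ab \<open>E b a\<close> by (simp add: in_nbhd)
    fix Q1 Q2
    assume Q: "max_clique (nbhd U b) Q1 \<and> max_clique (nbhd U b) Q2 \<and> Q1 \<inter> Q2 = {} \<and> a \<in> Q1"
    then have Q1: "max_clique (nbhd U b) Q1" and Q2: "max_clique (nbhd U b) Q2"
      and disj: "Q1 \<inter> Q2 = {}" and aQ: "a \<in> Q1" by blast+
    show "r \<in> Q1"
    proof (rule ccontr)
      assume "r \<notin> Q1"
      then have rQ: "r \<in> Q2"
        using max_cliques_cover[OF tame_U ab(2) Q1 Q2 disj] rU \<open>E b r\<close> by (auto simp: in_nbhd)
      obtain q where q: "q \<in> Q2" "\<not> E a q" "a \<noteq> q"
        using max_clique_nonadj[OF Q2, of a] aQ disj \<open>a \<in> nbhd U b\<close> by blast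
      have qb: "q \<in> U" "E b q" using max_cliqueD(1)[OF Q2 q(1)] by (auto simp: in_nbhd)
      then have "q \<noteq> b" using E_irrefl by blast
      then consider "q \<in> X" | "q \<in> Y" using Y(4) qb q by blast
      then show False
      proof cases
        case 1
        then show False using twins qb q by blast
      next
        case 2
        then have "q \<noteq> r" using r Y(3) by blast
        then have "E r q" using max_cliqueD(2)[OF Q2] rQ q by blast
        then show False using X r 2 Y(1,3) unfolding closed_in_def by blast
      qed
    qed
  qed
  have linked_Y: "linked Y"
    by (rule cut_side_linked[OF Y(1) X _ _ ab(1) ne]) (use r Y in blast)+
  \<comment> \<open>Since \<open>Y\<close> is connected and touches \<open>b\<close>,
    \<open>Z\<close> lies in \<open>X\<close>. There a neighbour of \<open>a\<close> is also one of
    \<open>b\<close>, so \<open>Z\<close> has no neighbour of \<open>a\<close> and is closed even in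
    \<open>U - {r}\<close>.\<close>
  have small: "Z = {}" if Z: "closed_in (U - {a, r}) Z" "b \<notin> Z" for Z
  proof -
    have "closed_in Y (Z \<inter> Y)"
      using Z(1) Y(4) r Y(3) unfolding closed_in_def by blast
    then have "Z \<inter> Y = {} \<or> Y \<subseteq> Z" using linked_Y unfolding linked_def by blast
    moreover have "\<not> Y \<subseteq> Z"
    proof
      assume "Y \<subseteq> Z"
      have "closed_in (U - {b, a}) Y" using Y(1) by (simp add: insert_commute)
      then obtain y where "y \<in> Y" "E b y" using closed_touches[OF _ Y(2) ab(2)] ne by blast
      then show False using Z \<open>Y \<subseteq> Z\<close> ab(2) ne rU E_sym unfolding closed_in_def by blast
    qed
    ultimately have "Z \<inter> Y = {}" by blast
    then have ZX: "Z \<subseteq> X" using Z Y(4) unfolding closed_in_def by blast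
    have "closed_in (U - {r}) Z"
      unfolding closed_in_def
    proof (intro conjI ballI impI)
      show "Z \<subseteq> U - {r}" using Z unfolding closed_in_def by blast
      fix x y assume xy: "x \<in> Z" "y \<in> U - {r}" "E x y"
      have "y \<noteq> a"
      proof
        assume "y = a"
        then have "E x b" using twins[of x] xy ZX E_sym by blast
        then show False using Z xy ab(2) ne rU unfolding closed_in_def by blast
      qed
      then show "y \<in> Z" using Z xy unfolding closed_in_def by blast
    qed
    then show ?thesis using linked_Diff_single[of r] Z(2) ab(2) rU unfolding linked_def by blast
  qed
  have "linked (U - {a, r})"
    unfolding linked_def
  proof (intro allI impI)
    fix Z assume Z: "closed_in (U - {a, r}) Z"
    show "Z = {} \<or> Z = U - {a, r}"
    \<comment> \<open>One of \<open>Z\<close> and its complement misses \<open>b\<close>.\<close>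
    proof (cases "b \<in> Z")
      case True
      then have "U - {a, r} - Z = {}" using small[OF closed_in_Diff[OF Z]] by blast
      then show ?thesis using Z unfolding closed_in_def by blast
    qed (use small[OF Z] in blast)
  qed
  then show False
    using no_anchored_linked[OF ab(1) rU(1) _ _ anch] rU ab(2) ne by blast
qed

text \<open>The vertex \<open>x\<close> and a claw at \<open>a\<close> make every neighbour of
  \<open>a\<close> in \<open>Y\<close> a neighbour of \<open>b\<close>. A neighbour of
  \<open>a\<close> in \<open>Y\<close> is then anchored, so each side has its own root.\<close>

lemma no_untwinned_cut:
  assumes X: "closed_in (U - {a, b}) X" and Y: "closed_in (U - {a, b}) Y" "Y \<noteq> {}" "X \<inter> Y = {}" "X \<union> Y = U - {a, b}"
    and ab: "a \<in> U" "b \<in> U" "E a b" and r: "r \<in> X" "anchored a b r"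
    and x: "x \<in> X" "E a x" "\<not> E b x"
  shows False
proof -
  have ne: "a \<noteq> b" using ab E_irrefl by blast
  have "E b a" using ab E_sym by blast
  have sub: "X \<subseteq> U - {a, b}" "Y \<subseteq> U - {a, b}" using X Y unfolding closed_in_def by blast+
  have common: "E b p" if p: "p \<in> Y" "E a p" for p
  proof -
    have "\<not> E x p" using X x p sub Y(3) unfolding closed_in_def by blast
    moreover have "b \<noteq> x" "b \<noteq> p" "x \<noteq> p" using sub x p Y(3) by blast+
    ultimately show ?thesis using claw[of a b x p] ab x p by blast
  qed
  obtain r' where r': "r' \<in> Y" "E a r'" using closed_touches[OF Y(1,2) ab(1) ne] by blast
  have r'U: "r' \<in> U" "E r' a" using r' sub E_sym by blast+
  have anch: "anchored a b r'"
    unfolding anchored_def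
  proof (intro conjI allI impI)
    show "a \<in> nbhd U r'" using ab r'U by (simp add: in_nbhd)
    fix Q1 Q2
    assume Q: "max_clique (nbhd U r') Q1 \<and> max_clique (nbhd U r') Q2 \<and> Q1 \<inter> Q2 = {} \<and> a \<in> Q1"
    show "b \<in> Q1"
    proof (rule ccontr)
      assume "b \<notin> Q1"
      moreover have "b \<in> nbhd U r'" using common[OF r'] ab(2) E_sym by (simp add: in_nbhd)
      ultimately obtain p where p: "p \<in> Q1" "\<not> E b p" "b \<noteq> p"
        using max_clique_nonadj Q by blast
      then have "p \<noteq> a" using \<open>E b a\<close> by blast
      then have "E a p" using Q p max_cliqueD(2) by blast
      have "p \<in> nbhd U r'" using Q p max_cliqueD(1) by blast
      then have "p \<in> U" "E r' p" by (auto simp: in_nbhd)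
      then have "p \<in> Y" using Y(1) r' p \<open>p \<noteq> a\<close> unfolding closed_in_def by blast
      then show False using common \<open>E a p\<close> p by blast
    qed
  qed
  have lX: "linked X" by (rule cut_side_linked[OF X Y(1-3) ab(1) ne])
  have lY: "linked Y" by (rule cut_side_linked[OF Y(1) X _ _ ab(1) ne]) (use r Y in blast)+
  obtain dX :: "'a \<Rightarrow> nat" where dX: "\<And>v. v \<in> X \<Longrightarrow> v \<noteq> r \<Longrightarrow> \<exists>w\<in>X. E v w \<and> dX w < dX v"
    using linked_rank[OF lX r(1)] by blast
  obtain dY :: "'a \<Rightarrow> nat" where dY: "\<And>v. v \<in> Y \<Longrightarrow> v \<noteq> r' \<Longrightarrow> \<exists>w\<in>Y. E v w \<and> dY w < dY v"
    using linked_rank[OF lY r'(1)] by blast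
  \<comment> \<open>Descending neighbours stay on their own side, so the two distance functions
    combine into one ranking.\<close>
  define d where "d v = (if v \<in> X then dX v else dY v)" for v
  show False
  proof (rule no_anchored_ranking[OF ab(1,2) ne, of d])
    fix v assume "v \<in> U - {a, b}"
    then consider "v \<in> X" | "v \<in> Y" "v \<notin> X" using Y(4) by blast
    then show "anchored a b v \<or> (\<exists>w\<in>U - {a, b}. E v w \<and> d w < d v)"
    proof cases
      case 1
      show ?thesis
      proof (cases "v = r")
        case False
        then obtain w where "w \<in> X" "E v w" "dX w < dX v" using dX 1 by blast
        then show ?thesis using 1 sub by (auto simp: d_def intro!: bexI[of _ w])
      qed (use r in simp)
    next
      case 2
      show ?thesis
      proof (cases "v = r'")
        case False
        then obtain w where "w \<in> Y" "E v w" "dY w < dY v" using dY 2 by blast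
        moreover from this have "w \<notin> X" using Y(3) by blast
        ultimately show ?thesis using 2 sub by (auto simp: d_def intro!: bexI[of _ w])
      qed (use anch in simp)
    qed
  qed
qed

text \<open>Uniqueness of the pair anchors \<open>r\<close> for \<open>a\<close> and
  \<open>b\<close> in both orders, so \<open>U - {a, b}\<close> is disconnected. On the side of
  \<open>r\<close>, the vertices \<open>a\<close> and \<open>b\<close> are twins or some vertex is
  adjacent to just one of them; both cases are excluded.\<close>

lemma clique_pair_small:
  assumes r: "r \<in> U" and Q1: "max_clique (nbhd U r) Q1" and Q2: "max_clique (nbhd U r) Q2"
    and disj: "Q1 \<inter> Q2 = {}" and ab: "a \<in> Q1" "b \<in> Q1"
  shows "a = b"
proof (rule ccontr)
  assume ne: "a \<noteq> b"
  have abN: "a \<in> U" "b \<in> U" "E r a" "E r b" "E a b" "a \<in> nbhd U r" "b \<in> nbhd U r"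
    using max_cliqueD(1,2)[OF Q1] ab ne by (auto simp: in_nbhd)
  have rn: "r \<noteq> a" "r \<noteq> b" using abN E_irrefl by blast+
  have anch: "anchored a b r" "anchored b a r"
    unfolding anchored_def
    using max_cliques_pair_unique[OF tame_U r Q1 Q2 disj _ _ _ ab ne]
      max_cliques_pair_unique[OF tame_U r Q1 Q2 disj _ _ _ ab(2,1)] ne abN by blast+
  have "\<not> linked (U - {a, b})"
    using no_anchored_linked[OF abN(1,2) ne _ anch(1)] r rn by blast
  then obtain Z where Z: "closed_in (U - {a, b}) Z" "Z \<noteq> {}" "Z \<noteq> U - {a, b}"
    unfolding linked_def by blast
  have ZU: "Z \<subseteq> U - {a, b}" using Z unfolding closed_in_def by blast
  obtain X Y where XY: "closed_in (U - {a, b}) X" "closed_in (U - {a, b}) Y" "Y \<noteq> {}" "X \<inter> Y = {}"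
    "X \<union> Y = U - {a, b}" "r \<in> X"
  proof (cases "r \<in> Z")
    case True
    then show ?thesis using that[OF Z(1) closed_in_Diff[OF Z(1)]] Z ZU by blast
  next
    case False
    then show ?thesis using that[OF closed_in_Diff[OF Z(1)] Z(1)] Z ZU r rn by blast
  qed
  note XY' = XY(1-5)[unfolded insert_commute[of a b]]
  have "\<not> (E a x \<and> \<not> E b x)" if "x \<in> X" for x
    using no_untwinned_cut[OF XY(1-5) abN(1,2,5) XY(6) anch(1) that] by blast
  moreover have "\<not> (E b x \<and> \<not> E a x)" if "x \<in> X" for x
    using no_untwinned_cut[OF XY' abN(2,1) E_sym[OF abN(5)] XY(6) anch(2) that] by blast
  ultimately have "E a x \<longleftrightarrow> E b x" if "x \<in> X" for x using that by blast
  then show False using no_twin_cut[OF XY(1-5) abN(1,2,5) XY(6) abN(4)] by blast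
qed

lemma nbhd_two:
  assumes r: "r \<in> U"
  obtains x y where "nbhd U r = {x, y}" "x \<noteq> y" "\<not> E x y"
proof -
  obtain Q1 Q2 where Q1: "max_clique (nbhd U r) Q1" and Q2: "max_clique (nbhd U r) Q2"
    and disj: "Q1 \<inter> Q2 = {}" using conflicting_cliques[OF r] by blast
  have cover: "nbhd U r \<subseteq> Q1 \<union> Q2" by (rule max_cliques_cover[OF tame_U r Q1 Q2 disj])
  have sub: "Q1 \<subseteq> nbhd U r" "Q2 \<subseteq> nbhd U r" using Q1 Q2 unfolding max_clique_def by blast+
  \<comment> \<open>An empty neighbourhood has the empty set as maximal clique, so this case is
    excluded separately.\<close>
  have "nbhd U r \<noteq> {}"
  proof
    assume none: "nbhd U r = {}"
    then have "closed_in U {r}" using r unfolding closed_in_def nbhd_def by blast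
    then have "U = {r}" using linked_U unfolding linked_def by blast
    then show False using universal_colorable[of r U] not_colorable by blast
  qed
  then obtain z where z: "z \<in> nbhd U r" by blast
  have "Q1 \<noteq> {}" using z Q1 unfolding max_clique_def by blast
  then obtain x where "x \<in> Q1" by blast
  then have Qx: "Q1 = {x}" using clique_pair_small[OF r Q1 Q2 disj] by blast
  have "Q2 \<noteq> {}" using z Q2 unfolding max_clique_def by blast
  then obtain y where "y \<in> Q2" by blast
  moreover have "Q2 \<inter> Q1 = {}" using disj by blast
  ultimately have Qy: "Q2 = {y}" using clique_pair_small[OF r Q2 Q1] by blast
  have "x \<noteq> y" using Qx Qy disj by blast
  moreover have "\<not> E x y" using max_clique_nonadj[OF Q2, of x] sub Qx Qy \<open>x \<noteq> y\<close> by blast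
  moreover have "nbhd U r = {x, y}" using cover sub unfolding Qx Qy by blast
  ultimately show ?thesis using that by blast
qed

section \<open>From degree two to a cycle\<close>

lemma nbhd_eq:
  assumes "r \<in> U" "x \<in> U" "y \<in> U" "E r x" "E r y" "x \<noteq> y"
  shows "nbhd U r = {x, y}" and "\<not> E x y"
proof -
  obtain u w where "nbhd U r = {u, w}" "u \<noteq> w" "\<not> E u w" by (rule nbhd_two[OF assms(1)])
  moreover have "x \<in> nbhd U r" "y \<in> nbhd U r" using assms by (auto simp: in_nbhd)
  ultimately show "nbhd U r = {x, y}" "\<not> E x y" using assms(6) E_sym by auto
qed

text \<open>Both neighbours of an end of a longest path lie on the path, so the path closes to a cycle.\<close>

lemma cycle_exists:
  obtains n f where "n \<ge> 3" "cycle_on E n f U"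
proof -
  define path where "path p \<longleftrightarrow> distinct p \<and> set p \<subseteq> U \<and> (\<forall>i. Suc i < length p \<longrightarrow> E (p ! i) (p ! Suc i))" for p
  have "U \<noteq> {}"
  proof
    assume "U = {}"
    then have "valid_on U U (\<lambda>_. True)" by (auto simp: valid_on_def max_clique_def)
    then show False using not_colorable unfolding colorable_def by blast
  qed
  then obtain r where "path [r]" unfolding path_def by auto
  moreover have "length p < Suc (card U)" if "path p" for p
    using that finite_U unfolding path_def by (metis card_mono distinct_card less_Suc_eq_le)
  ultimately obtain p where p: "path p" and longest: "\<And>q. path q \<Longrightarrow> length q \<le> length p" and "length p \<ge> 1"
    using ex_has_greatest_nat[of path "[r]" length "Suc (card U)"] by fastforce
  define n where "n = length p"
  have dist: "distinct p" and pU: "set p \<subseteq> U" and step: "\<And>i. Suc i < n \<Longrightarrow> E (p ! i) (p ! Suc i)"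
    using p by (auto simp: path_def n_def)
  have n1: "n \<ge> 1" using \<open>length p \<ge> 1\<close> by (simp add: n_def)
  have U: "p ! i \<in> U" if "i < n" for i using that pU nth_mem by (auto simp: n_def)
  have inj: "p ! i = p ! j \<longleftrightarrow> i = j" if "i < n" "j < n" for i j
    using that dist by (simp add: nth_eq_iff_index_eq n_def)
  have last_nbhd: "nbhd U (p ! (n - 1)) \<subseteq> set p"
  proof
    fix y assume y: "y \<in> nbhd U (p ! (n - 1))"
    show "y \<in> set p"
    proof (rule ccontr)
      assume "y \<notin> set p"
      have "E ((p @ [y]) ! i) ((p @ [y]) ! Suc i)" if "Suc i < length (p @ [y])" for i
      proof (cases "Suc i < n")
        case True
        then show ?thesis using step[OF True] by (simp add: nth_append n_def)
      next
        case False
        then have "i = n - 1" "Suc i = length p" using that by (auto simp: n_def)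
        then have "(p @ [y]) ! i = p ! (n - 1)" "(p @ [y]) ! Suc i = y"
          by (simp_all add: nth_append)
        then show ?thesis using y by (simp add: in_nbhd)
      qed
      then have "path (p @ [y])" using p y \<open>y \<notin> set p\<close> by (auto simp: path_def in_nbhd)
      then show False using longest by fastforce
    qed
  qed
  have "p ! (n - 1) \<in> U" using U n1 by simp
  then obtain u w where uw: "nbhd U (p ! (n - 1)) = {u, w}" "u \<noteq> w" by (rule nbhd_two)
  have "p ! (n - 1) \<notin> {u, w}" using uw(1) E_irrefl unfolding nbhd_def by blast
  then have "card {p ! (n - 1), u, w} = 3" using uw(2) by auto
  moreover have "{p ! (n - 1), u, w} \<subseteq> set p" using last_nbhd uw(1) n1 by (auto simp: n_def)
  ultimately have n3: "n \<ge> 3" using card_mono[of "set p" "{p ! (n - 1), u, w}"] distinct_card[OF dist] by (simp add: n_def)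
  have mid: "nbhd U (p ! i) = {p ! (i - 1), p ! Suc i}" if i: "0 < i" "Suc i < n" for i
  proof (rule nbhd_eq(1))
    show "E (p ! i) (p ! (i - 1))" using step[of "i - 1"] i E_sym by simp
    show "E (p ! i) (p ! Suc i)" using step i by blast
    show "p ! (i - 1) \<noteq> p ! Suc i" using inj[of "i - 1" "Suc i"] i by simp
  qed (use U i in auto)
  have pen: "p ! (n - 2) \<in> nbhd U (p ! (n - 1))"
    using step[of "n - 2"] n3 U[of "n - 2"] E_sym by (simp add: in_nbhd numeral_2_eq_2 Suc_diff_Suc)
  obtain y where y: "y \<in> nbhd U (p ! (n - 1))" "y \<noteq> p ! (n - 2)" using uw by blast
  then obtain j where j: "j < n" "y = p ! j" using last_nbhd by (metis in_set_conv_nth n_def subsetD)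
  have "j \<noteq> n - 1" using y j E_irrefl by (auto simp: in_nbhd)
  have "j \<noteq> n - 2" using y j by blast
  \<comment> \<open>An inner vertex already has its two neighbours next to it on the path, so only
    the first vertex can be the second neighbour of the last.\<close>
  have "j = 0"
  proof (rule ccontr)
    assume "j \<noteq> 0"
    then have "Suc j < n" using j \<open>j \<noteq> n - 1\<close> by linarith
    have "p ! (n - 1) \<in> nbhd U (p ! j)" using y j U[of "n - 1"] n3 E_sym by (simp add: in_nbhd)
    then have "p ! (n - 1) = p ! (j - 1) \<or> p ! (n - 1) = p ! Suc j"
      using mid[of j] \<open>j \<noteq> 0\<close> \<open>Suc j < n\<close> by auto
    then show False
      using inj[of "n - 1" "j - 1"] inj[of "n - 1" "Suc j"] \<open>Suc j < n\<close> \<open>j \<noteq> n - 2\<close> by auto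
  qed
  then have close: "E (p ! (n - 1)) (p ! 0)" "E (p ! 0) (p ! (n - 1))" using y j E_sym by (auto simp: in_nbhd)
  have succ: "E (p ! i) (p ! (Suc i mod n))" if "i < n" for i
  proof (cases "Suc i = n")
    case True
    then show ?thesis using close(1) by (simp flip: True)
  next
    case False
    then show ?thesis using step[of i] that by simp
  qed
  have nbrs: "j = Suc i mod n \<or> i = Suc j mod n" if ij: "i < n" "j < n" "E (p ! i) (p ! j)" for i j
  proof -
    define k where "k = (if i = 0 then n - 1 else i - 1)"
    have k: "k < n" "Suc k mod n = i" using ij n3 by (auto simp: k_def mod_Suc)
    have "Suc i mod n < n" "Suc i mod n \<noteq> k" using ij n3 by (auto simp: k_def mod_Suc split: if_splits)
    have "nbhd U (p ! i) = {p ! (Suc i mod n), p ! k}"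
    proof (rule nbhd_eq(1))
      show "E (p ! i) (p ! k)" using succ[OF k(1)] k E_sym by simp
      show "p ! (Suc i mod n) \<noteq> p ! k" using inj k \<open>Suc i mod n < n\<close> \<open>Suc i mod n \<noteq> k\<close> by blast
    qed (use U succ ij k \<open>Suc i mod n < n\<close> in auto)
    moreover have "p ! j \<in> nbhd U (p ! i)" using ij U by (simp add: in_nbhd)
    ultimately have "p ! j = p ! (Suc i mod n) \<or> p ! j = p ! k" by simp
    then show ?thesis using inj ij k \<open>Suc i mod n < n\<close> by blast
  qed
  \<comment> \<open>Connectedness of \<open>U\<close> then puts all vertices on the path.\<close>
  have "closed_in U (set p)"
    unfolding closed_in_def
  proof (intro conjI ballI impI pU)
    fix x y assume "x \<in> set p" "y \<in> U" "E x y"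
    then obtain i where i: "i < n" "x = p ! i" by (metis in_set_conv_nth n_def)
    have y: "y \<in> nbhd U (p ! i)" using i \<open>y \<in> U\<close> \<open>E x y\<close> by (simp add: in_nbhd)
    consider "0 < i" "Suc i < n" | "i = 0" | "i = n - 1" using i by linarith
    then show "y \<in> set p"
    proof cases
      case 1
      then show ?thesis using y mid[OF 1] i by (auto simp: n_def)
    next
      case 2
      have "nbhd U (p ! 0) = {p ! 1, p ! (n - 1)}"
      proof (rule nbhd_eq(1))
        show "E (p ! 0) (p ! 1)" using step[of 0] n3 by simp
        show "p ! 1 \<noteq> p ! (n - 1)" using inj[of 1 "n - 1"] n3 by simp
      qed (use U n3 close in auto)
      then show ?thesis using y 2 n3 by (auto simp: n_def)
    next
      case 3
      then show ?thesis using y last_nbhd by blast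
    qed
  qed
  then have pU': "set p = U" using linked_U n1 unfolding linked_def n_def by fastforce
  have "cycle_on E n ((!) p) U"
    unfolding cycle_on_def
  proof (intro conjI allI impI)
    show "bij_betw ((!) p) {..<n} U" using bij_betw_nth[OF dist, of "{..<n}" U] pU' by (simp add: n_def)
    fix i j assume "i < n" "j < n"
    then show "E (p ! i) (p ! j) \<longleftrightarrow> j = Suc i mod n \<or> i = Suc j mod n"
      using nbrs[of i j] succ[of i] succ[of j] E_sym by metis
  qed
  then show ?thesis using that n3 by blast
qed

text \<open>Length 3 is excluded because the two neighbours of a vertex are nonadjacent, larger odd
  lengths by \<open>no_long_odd\<close>. An even cycle is coloured by parity of position.\<close>

lemma inconsistent: False
proof -
  obtain n f where n: "n \<ge> 3" and cyc: "cycle_on E n f U" by (rule cycle_exists)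
  have bij: "bij_betw f {..<n} U"
    and adj: "\<And>i j. i < n \<Longrightarrow> j < n \<Longrightarrow> E (f i) (f j) \<longleftrightarrow> j = Suc i mod n \<or> i = Suc j mod n"
    using cyc by (auto simp: cycle_on_def)
  have inj: "f i = f j \<longleftrightarrow> i = j" if "i < n" "j < n" for i j
    using that bij by (auto simp: bij_betw_def inj_on_def)
  have fU: "f i \<in> U" if "i < n" for i using that bij by (auto simp: bij_betw_def)
  have "n \<noteq> 3"
  proof
    assume "n = 3"
    then have "E (f 0) (f 1)" "E (f 0) (f 2)" "E (f 1) (f 2)" "f 1 \<noteq> f 2" using adj inj by auto
    then show False using nbhd_eq(2)[of "f 0" "f 1" "f 2"] fU \<open>n = 3\<close> by auto
  qed
  moreover have "closed_in U U" by (simp add: closed_in_def)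
  ultimately have "even n" using no_long_odd[of U] cyc n unfolding long_odd_component_def by (metis le_neq_implies_less)
  define c where "c v \<longleftrightarrow> (\<exists>i<n. even i \<and> v = f i)" for v
  have c: "c (f i) \<longleftrightarrow> even i" if "i < n" for i using that inj by (auto simp: c_def)
  have "valid_on U U c"
  proof (rule valid_onI)
    fix K x y assume K: "max_clique U K" and xy: "x \<in> K" "y \<in> K" "x \<noteq> y" and mono: "\<exists>b. \<forall>z\<in>K. c z = b"
    have "x \<in> U" "y \<in> U" "E x y" using max_cliqueD(1,2)[OF K] xy by blast+
    then obtain i j where ij: "i < n" "j < n" "x = f i" "y = f j" using bij by (auto simp: bij_betw_def)
    then have "j = Suc i mod n \<or> i = Suc j mod n" using adj \<open>E x y\<close> by blast
    then have "even i \<noteq> even j" using ij \<open>even n\<close> by (auto simp: mod_Suc split: if_splits)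
    then have "c x \<noteq> c y" using c ij by blast
    then show False using mono xy by blast
  qed
  then show False using not_colorable unfolding colorable_def by blast
qed

end

context sparse_claw_free
begin

text \<open>Induction over proper subsets supplies \<open>proper_colorable\<close>, so a failing
  \<open>W\<close> would be a minimal counterexample.\<close>

lemma colorable_if_no_long_odd:
  assumes "W \<subseteq> V" "\<And>D. \<not> long_odd_component W D"
  shows "colorable W"
  using finite_subset[OF assms(1) finite_V] assms
proof (induction W rule: finite_psubset_induct)
  case (psubset W)
  show ?case
  proof (rule ccontr)
    assume "\<not> colorable W"
    then interpret minimal_noncolorable E V W
      by unfold_locales (use psubset in auto)
    show False by (rule inconsistent)
  qed
qed

end

section \<open>Minors and components\<close>

lemma minor_step_delete_vertices:
  assumes "finite D" "D \<subseteq> pverts G"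
  shows "minor_step\<^sup>*\<^sup>* G \<lparr>pverts = pverts G - D, parcs = {(x, y) \<in> parcs G. x \<notin> D \<and> y \<notin> D}\<rparr>"
  using assms
proof (induction D rule: finite_induct)
  case empty
  then show ?case by (cases G) (simp add: case_prod_unfold)
next
  case (insert v D)
  let ?H = "\<lparr>pverts = pverts G - D, parcs = {(x, y) \<in> parcs G. x \<notin> D \<and> y \<notin> D}\<rparr>"
  have "minor_step ?H (delete_vertex ?H v)"
    by (rule vertex_deletion) (use insert in auto)
  moreover have "delete_vertex ?H v =
      \<lparr>pverts = pverts G - insert v D, parcs = {(x, y) \<in> parcs G. x \<notin> insert v D \<and> y \<notin> insert v D}\<rparr>"
    by (auto simp: delete_vertex_def)
  ultimately show ?case using insert by (auto intro: rtranclp.rtrancl_into_rtrancl)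
qed

text \<open>Deleting an edge removes two opposite arcs, whence the symmetry of \<open>F\<close> and
  an induction over proper subsets.\<close>

lemma minor_step_delete_edges:
  assumes "finite F" "sym F" "F \<subseteq> parcs G"
  shows "minor_step\<^sup>*\<^sup>* G \<lparr>pverts = pverts G, parcs = parcs G - F\<rparr>"
  using assms
proof (induction F rule: finite_psubset_induct)
  case (psubset F)
  show ?case
  proof (cases "F = {}")
    case False
    then obtain u v where uv: "(u, v) \<in> F" by auto
    define F' where "F' = F - {(u, v), (v, u)}"
    let ?H = "\<lparr>pverts = pverts G, parcs = parcs G - F'\<rparr>"
    have "F' \<subset> F" "sym F'" "F' \<subseteq> parcs G" using uv psubset(3,4) by (auto simp: F'_def sym_def)
    then have "minor_step\<^sup>*\<^sup>* G ?H" using psubset(2) by blast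
    moreover have "minor_step ?H (delete_edge ?H u v)"
      by (rule edge_deletion) (use uv psubset in \<open>auto simp: F'_def\<close>)
    moreover have "delete_edge ?H u v = \<lparr>pverts = pverts G, parcs = parcs G - F\<rparr>"
      using uv psubset(3) by (auto simp: delete_edge_def F'_def sym_def)
    ultimately show ?thesis by (metis rtranclp.rtrancl_into_rtrancl)
  qed (cases G, simp)
qed

text \<open>Delete the vertices outside \<open>A \<union> B\<close>, then the edges inside
  \<open>A\<close> and inside \<open>B\<close>.\<close>

lemma K33_minor_if_subgraph:
  assumes fin: "finite (pverts G)" and wf: "parcs G \<subseteq> pverts G \<times> pverts G" and sym: "sym (parcs G)"
    and AB: "A \<subseteq> pverts G" "B \<subseteq> pverts G" "A \<inter> B = {}" "card A = 3" "card B = 3" "A \<times> B \<subseteq> parcs G"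
  shows "\<not> K33_minor_free G"
proof -
  define D where "D = pverts G - (A \<union> B)"
  define H where "H = \<lparr>pverts = pverts G - D, parcs = {(x, y) \<in> parcs G. x \<notin> D \<and> y \<notin> D}\<rparr>"
  have GH: "minor_step\<^sup>*\<^sup>* G H"
    unfolding H_def by (rule minor_step_delete_vertices) (use fin in \<open>auto simp: D_def\<close>)
  have finAB: "finite A" "finite B" using AB by (auto intro: card_ge_0_finite)
  have BA: "B \<times> A \<subseteq> parcs G" using AB(6) sym by (auto dest: symD)
  have H: "pverts H = A \<union> B" "parcs H \<subseteq> (A \<union> B) \<times> (A \<union> B)" "sym (parcs H)" "A \<times> B \<union> B \<times> A \<subseteq> parcs H"
    using AB BA wf sym by (auto simp: H_def D_def sym_def)
  define F where "F = parcs H - (A \<times> B \<union> B \<times> A)"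
  have "minor_step\<^sup>*\<^sup>* H \<lparr>pverts = pverts H, parcs = parcs H - F\<rparr>"
  proof (rule minor_step_delete_edges)
    show "finite F" using H(2) finAB by (auto simp: F_def intro: finite_subset)
    show "sym F" using H(3) by (auto simp: F_def sym_def)
  qed (auto simp: F_def)
  moreover have "\<lparr>pverts = pverts H, parcs = parcs H - F\<rparr> = \<lparr>pverts = A \<union> B, parcs = A \<times> B \<union> B \<times> A\<rparr>"
    using H by (auto simp: F_def)
  ultimately have "minor_step\<^sup>*\<^sup>* G \<lparr>pverts = A \<union> B, parcs = A \<times> B \<union> B \<times> A\<rparr>"
    using GH by (metis rtranclp_trans)
  moreover have "complete_bipartite_digraph 3 3 (with_proj \<lparr>pverts = A \<union> B, parcs = A \<times> B \<union> B \<times> A\<rparr>)"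
    unfolding complete_bipartite_digraph_pair_def using AB finAB by auto
  ultimately show ?thesis unfolding K33_minor_free_def by blast
qed

section \<open>Translation between graphs and adjacency relations\<close>

context pair_graph
begin

lemma parcs_symD: "(x, y) \<in> parcs G \<Longrightarrow> (y, x) \<in> parcs G"
  by (rule arcs_symmetric)

lemma parcs_irrefl: "(x, x) \<notin> parcs G"
  using pair_no_loops[of "(x, x)"] by auto

lemma parcs_pverts: "(x, y) \<in> parcs G \<Longrightarrow> x \<in> pverts G \<and> y \<in> pverts G"
  using arc_fst_in_verts[of "(x, y)"] arc_snd_in_verts[of "(x, y)"] by auto

lemma induced_subgraph_with_proj:
  assumes "D \<subseteq> pverts G"
  shows "induced_subgraph (with_proj \<lparr>pverts = D, parcs = parcs G \<inter> D \<times> D\<rparr>) (with_proj G)"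
proof -
  have "wf_digraph (with_proj \<lparr>pverts = D, parcs = parcs G \<inter> D \<times> D\<rparr>)"
    by unfold_locales auto
  moreover have "wf_digraph (with_proj G)" by unfold_locales
  ultimately show ?thesis
    using assms by (auto simp: induced_subgraph_def subgraph_def compatible_def)
qed

lemma claw_freeD:
  assumes "claw_free G" "(v, x) \<in> parcs G" "(v, y) \<in> parcs G" "(v, z) \<in> parcs G"
    "x \<noteq> y" "x \<noteq> z" "y \<noteq> z"
  shows "(x, y) \<in> parcs G \<or> (x, z) \<in> parcs G \<or> (y, z) \<in> parcs G"
proof (rule ccontr)
  assume none: "\<not> ?thesis"
  let ?D = "{v, x, y, z}"
  let ?H = "\<lparr>pverts = ?D, parcs = parcs G \<inter> ?D \<times> ?D\<rparr>"
  have "(y, x) \<notin> parcs G" "(z, x) \<notin> parcs G" "(z, y) \<notin> parcs G"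
    using none parcs_symD by blast+
  moreover have "(x, v) \<in> parcs G" "(y, v) \<in> parcs G" "(z, v) \<in> parcs G"
    using assms parcs_symD by blast+
  ultimately have "parcs G \<inter> ?D \<times> ?D = {v} \<times> {x, y, z} \<union> {x, y, z} \<times> {v}"
    using none assms(2-4) parcs_irrefl by auto
  moreover have "v \<notin> {x, y, z}" using assms parcs_irrefl by blast
  moreover have "card {x, y, z} = 3" using assms by simp
  ultimately have "\<exists>A B. pverts ?H = A \<union> B \<and> A \<inter> B = {} \<and> card A = 1 \<and> card B = 3
      \<and> parcs ?H = A \<times> B \<union> B \<times> A"
    by - (rule exI[of _ "{v}"], rule exI[of _ "{x, y, z}"], simp, blast)
  moreover have "finite (pverts ?H)" by simp
  ultimately have "complete_bipartite_digraph 1 3 (with_proj ?H)"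
    unfolding complete_bipartite_digraph_pair_def by blast
  moreover have "induced_subgraph (with_proj ?H) (with_proj G)"
    by (rule induced_subgraph_with_proj) (use assms(2-4) parcs_pverts in auto)
  ultimately show False using assms(1) unfolding claw_free_def by blast
qed

text \<open>If \<open>s\<close> and \<open>t\<close> differ, contracting their edge yields a vertex,
  again called \<open>s\<close>, adjacent to \<open>x1\<close>, \<open>x2\<close> and
  \<open>x3\<close>; then a subgraph suffices.\<close>

lemma K33_minor_freeD:
  assumes free: "K33_minor_free G"
    and y1: "(x1, y1) \<in> parcs G" "(x2, y1) \<in> parcs G" "(x3, y1) \<in> parcs G"
    and y2: "(x1, y2) \<in> parcs G" "(x2, y2) \<in> parcs G" "(x3, y2) \<in> parcs G"
    and st: "(x1, s) \<in> parcs G \<or> (x1, t) \<in> parcs G" "(x2, s) \<in> parcs G \<or> (x2, t) \<in> parcs G"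
      "(x3, s) \<in> parcs G \<or> (x3, t) \<in> parcs G" "s = t \<or> (s, t) \<in> parcs G"
    and dist: "distinct [x1, x2, x3]" "distinct [y1, y2, s]" "t \<noteq> y1" "t \<noteq> y2"
      "{x1, x2, x3} \<inter> {y1, y2, s, t} = {}"
  shows False
proof (cases "s = t")
  case True
  have "\<not> K33_minor_free G"
  proof (rule K33_minor_if_subgraph[of _ "{x1, x2, x3}" "{y1, y2, s}"])
    show "finite (pverts G)" by (rule pair_finite_verts)
    show "parcs G \<subseteq> pverts G \<times> pverts G" using parcs_pverts by auto
    show "sym (parcs G)" using parcs_symD by (auto simp: sym_def)
    show "{x1, x2, x3} \<subseteq> pverts G" "{y1, y2, s} \<subseteq> pverts G"
      using y1 y2 st True parcs_pverts by blast+
  qed (use y1 y2 st dist True in auto)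
  then show False using free by blast
next
  case False
  then have arc: "(s, t) \<in> parcs G" using st by blast
  let ?H = "contract_edge G s t"
  define f where "f x = (if x = t then s else x)" for x
  have pH: "pverts ?H = pverts G - {t}"
    and aH: "parcs ?H = {(f x, f y) | x y. (x, y) \<in> parcs G \<and> f x \<noteq> f y}"
    by (simp_all add: contract_edge_def f_def Let_def)
  have arcH: "(u, w) \<in> parcs ?H" if "(x, y) \<in> parcs G" "u = f x" "w = f y" "u \<noteq> w" for x y u w
    unfolding aH using that by blast
  have "s \<in> pverts G" using arc parcs_pverts by blast
  have "\<not> K33_minor_free ?H"
  proof (rule K33_minor_if_subgraph[of _ "{x1, x2, x3}" "{y1, y2, s}"])
    show "finite (pverts ?H)" using pair_finite_verts pH by simp
    show "parcs ?H \<subseteq> pverts ?H \<times> pverts ?H"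
      unfolding aH pH using parcs_pverts \<open>s \<in> pverts G\<close> False by (auto simp: f_def)
    show "sym (parcs ?H)"
    proof (rule symI)
      fix u w assume "(u, w) \<in> parcs ?H"
      then obtain x y where "u = f x" "w = f y" "(x, y) \<in> parcs G" "f x \<noteq> f y" unfolding aH by blast
      then show "(w, u) \<in> parcs ?H" using arcH[OF parcs_symD, of x y w u] by simp
    qed
    show "{x1, x2, x3} \<subseteq> pverts ?H" "{y1, y2, s} \<subseteq> pverts ?H"
      using y1 y2 \<open>s \<in> pverts G\<close> dist False parcs_pverts unfolding pH by blast+
    \<comment> \<open>\<open>t\<close> is none of these vertices, so the contraction moves none of
      them.\<close>
    have fx: "f x = x" if "x \<in> {x1, x2, x3, y1, y2, s}" for x
      using that dist False by (auto simp: f_def)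
    have "(x, y) \<in> parcs ?H" if xy: "x \<in> {x1, x2, x3}" "y \<in> {y1, y2, s}" for x y
    proof -
      have "x \<noteq> y" using xy dist(5) by blast
      consider "(x, y) \<in> parcs G" | "y = s" "(x, t) \<in> parcs G"
        using xy y1 y2 st(1-3) by blast
      then show ?thesis
      proof cases
        case 1
        then show ?thesis using arcH[OF 1] fx[of x] fx[of y] xy \<open>x \<noteq> y\<close> by auto
      next
        case 2
        then show ?thesis using arcH[OF 2(2)] fx[of x] 2(1) xy \<open>x \<noteq> y\<close> by (auto simp: f_def)
      qed
    qed
    then show "{x1, x2, x3} \<times> {y1, y2, s} \<subseteq> parcs ?H" by blast
  qed (use dist in auto)
  then obtain H where "minor_step\<^sup>*\<^sup>* ?H H" "complete_bipartite_digraph 3 3 (with_proj H)"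
    unfolding K33_minor_free_def by blast
  moreover have "minor_step G ?H" by (rule edge_contraction[OF arc])
  ultimately show False using free unfolding K33_minor_free_def by (meson converse_rtranclp_into_rtranclp)
qed

lemma sparse_claw_free:
  assumes "claw_free G" "K33_minor_free G"
  shows "sparse_claw_free (\<lambda>x y. (x, y) \<in> parcs G) (pverts G)"
proof (unfold_locales, goal_cases)
  case 1
  show ?case by (rule pair_finite_verts)
next
  case (2 x y)
  then show ?case using parcs_pverts by blast
next
  case (3 x y)
  then show ?case by (rule parcs_symD)
next
  case (4 x)
  show ?case by (rule parcs_irrefl)
next
  case (5 v x y z)
  then show ?case by (rule claw_freeD[OF assms(1)])
next
  case (6 x1 y1 x2 x3 y2 s t)
  then show ?case by (rule K33_minor_freeD[OF assms(2)])
qed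

text \<open>The cycle is strongly connected, and since \<open>D\<close> is closed under adjacency,
  no walk leads from it to a vertex of a larger strongly connected subgraph.\<close>

lemma cycle_component:
  assumes cyc: "cycle_on (\<lambda>x y. (x, y) \<in> parcs G) n f D" and n: "n \<ge> 3"
    and D: "D \<subseteq> pverts G" and closed: "\<And>x y. x \<in> D \<Longrightarrow> (x, y) \<in> parcs G \<Longrightarrow> y \<in> D"
  shows "\<exists>H\<in>pre_digraph.sccs (with_proj G). cycle_digraph n H"
proof
  define H where "H = \<lparr>pverts = D, parcs = parcs G \<inter> D \<times> D\<rparr>"
  have H: "pverts H = D" "parcs H = parcs G \<inter> D \<times> D" by (simp_all add: H_def)
  have bij: "bij_betw f {..<n} D"
    and adj: "\<And>i j. i < n \<Longrightarrow> j < n \<Longrightarrow> (f i, f j) \<in> parcs G \<longleftrightarrow> j = Suc i mod n \<or> i = Suc j mod n"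
    using cyc by (auto simp: cycle_on_def)
  have fD: "f i \<in> D" if "i < n" for i using that bij by (auto simp: bij_betw_def)
  have fin: "finite D" using D pair_finite_verts by (rule finite_subset)
  interpret H: pair_graph H
  proof
    show "finite (pverts H)" "finite (parcs H)" using fin by (auto simp: H)
    show "symmetric (with_proj H)" using parcs_symD by (auto simp: symmetric_def sym_def H)
    show "fst e \<noteq> snd e" if "e \<in> parcs H" for e using that parcs_irrefl by (cases e) (auto simp: H)
  qed (auto simp: H)
  have reach: "(f 0) \<rightarrow>\<^sup>*\<^bsub>with_proj H\<^esub> (f i)" if "i < n" for i
    using that
  proof (induction i)
    case 0
    then show ?case using fD by (auto simp: H)
  next
    case (Suc i)
    then have "(f i, f (Suc i)) \<in> parcs H" using adj[of i "Suc i"] fD by (auto simp: H)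
    then show ?case using Suc H.reachable_adj_trans[of "f 0" "f i" "f (Suc i)"] by simp
  qed
  have strong: "strongly_connected (with_proj H)"
  proof
    show "verts (with_proj H) \<noteq> {}" using fD[of 0] n by (auto simp: H)
    fix u v assume "u \<in> verts (with_proj H)" "v \<in> verts (with_proj H)"
    then obtain i j where "i < n" "j < n" "u = f i" "v = f j" using bij by (auto simp: H bij_betw_def)
    then have "(f 0) \<rightarrow>\<^sup>*\<^bsub>with_proj H\<^esub> u" "(f 0) \<rightarrow>\<^sup>*\<^bsub>with_proj H\<^esub> v" using reach by auto
    then show "u \<rightarrow>\<^sup>*\<^bsub>with_proj H\<^esub> v"
      using H.sym_arcs symmetric_reachable' H.reachable_trans by (metis symmetric_reachable)
  qed
  show "with_proj H \<in> pre_digraph.sccs (with_proj G)"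
    unfolding pre_digraph.sccs_def mem_Collect_eq
  proof (intro conjI)
    show "induced_subgraph (with_proj H) (with_proj G)"
      unfolding H_def by (rule induced_subgraph_with_proj[OF D])
    show "\<not> (\<exists>H'. induced_subgraph H' (with_proj G) \<and> strongly_connected H' \<and> verts (with_proj H) \<subset> verts H')"
    proof
      assume "\<exists>H'. induced_subgraph H' (with_proj G) \<and> strongly_connected H' \<and> verts (with_proj H) \<subset> verts H'"
      then obtain H' where H': "induced_subgraph H' (with_proj G)" "strongly_connected H'" "D \<subset> verts H'"
        by (auto simp: H)
      then obtain w where w: "w \<in> verts H'" "w \<notin> D" by blast
      have "f 0 \<in> D" using fD n by simp
      then have "(f 0) \<rightarrow>\<^sup>*\<^bsub>H'\<^esub> w" using H' w unfolding strongly_connected_def by blast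
      then have "(f 0, w) \<in> (arcs_ends H')\<^sup>*" by (rule reachable_rtranclI)
      moreover have "arcs_ends H' \<subseteq> parcs G"
        using H'(1) by (auto simp: induced_subgraph_def subgraph_def compatible_def arcs_ends_conv)
      ultimately have "(f 0, w) \<in> (parcs G)\<^sup>*" using rtrancl_mono by blast
      then have "w \<in> D" using \<open>f 0 \<in> D\<close> by induction (use closed in auto)
      then show False using w by blast
    qed
  qed (rule strong)
  have "parcs G \<inter> D \<times> D = (\<Union>i<n. {(f i, f (Suc i mod n)), (f (Suc i mod n), f i)})"
  proof (intro equalityI subsetI)
    fix e assume "e \<in> parcs G \<inter> D \<times> D"
    then obtain i j where ij: "i < n" "j < n" "e = (f i, f j)" "(f i, f j) \<in> parcs G"
      using bij by (auto simp: bij_betw_def)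
    then have "j = Suc i mod n \<or> i = Suc j mod n" using adj by blast
    then show "e \<in> (\<Union>i<n. {(f i, f (Suc i mod n)), (f (Suc i mod n), f i)})" using ij by auto
  next
    fix e assume "e \<in> (\<Union>i<n. {(f i, f (Suc i mod n)), (f (Suc i mod n), f i)})"
    then obtain i where "i < n" "e = (f i, f (Suc i mod n)) \<or> e = (f (Suc i mod n), f i)" by auto
    then show "e \<in> parcs G \<inter> D \<times> D" using adj[of i "Suc i mod n"] adj[of "Suc i mod n" i] fD by auto
  qed
  then show "cycle_digraph n (with_proj H)"
    unfolding cycle_digraph_def using n bij H.pair_graphD_graph by (auto simp: H)
qed

end

theorem theorem11:
  fixes G :: "'a pair_pre_digraph"
  assumes "pair_graph G"
    and "claw_free G"
    and "K33_minor_free G"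
    and "no_long_odd_cycle_component G"
  shows "clique_colorable 2 G"
proof -
  interpret pair_graph G by (rule assms(1))
  interpret sparse_claw_free "\<lambda>x y. (x, y) \<in> parcs G" "pverts G"
    by (rule sparse_claw_free[OF assms(2,3)])
  have "\<not> long_odd_component (pverts G) D" for D
  proof
    assume "long_odd_component (pverts G) D"
    then obtain n f where n: "odd n" "n > 3" "cycle_on (\<lambda>x y. (x, y) \<in> parcs G) n f D"
      and D: "closed_in (pverts G) D" unfolding long_odd_component_def by blast
    have "\<exists>H\<in>pre_digraph.sccs (with_proj G). cycle_digraph n H"
      by (rule cycle_component[OF n(3)]) (use n D parcs_pverts in \<open>auto simp: closed_in_def\<close>)
    then show False using assms(4) n unfolding no_long_odd_cycle_component_def by blast
  qed
  then obtain c where c: "valid_on (pverts G) (pverts G) c"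
    using colorable_if_no_long_odd[of "pverts G"] unfolding colorable_def by blast
  define c' :: "'a \<Rightarrow> nat" where "c' x = (if c x then 1 else 2)" for x
  have "\<not> monochromatic c' K" if K: "maximal_clique G K" "card K \<ge> 2" for K
  proof
    assume mono: "monochromatic c' K"
    obtain x y where xy: "x \<in> K" "y \<in> K" "x \<noteq> y"
      using K(2) by (metis card_le_Suc0_iff_eq card.infinite not_less_eq_eq numeral_2_eq_2 zero_le)
    have cl: "clique G K" and ext: "\<And>K'. clique G K' \<Longrightarrow> \<not> K \<subset> K'"
      using K(1) unfolding maximal_clique_def by blast+
    \<comment> \<open>Maximality among cliques reduces to adding a single vertex.\<close>
    have "max_clique (pverts G) K"
      unfolding max_clique_def
    proof (intro conjI ballI)
      show "K \<subseteq> pverts G" using cl by (simp add: clique_def)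
      show "u \<noteq> v \<longrightarrow> (u, v) \<in> parcs G" if "u \<in> K" "v \<in> K" for u v
        using cl that by (simp add: clique_def)
      fix u assume u: "u \<in> pverts G - K"
      show "\<exists>v\<in>K. (u, v) \<notin> parcs G"
      proof (rule ccontr)
        assume "\<not> ?thesis"
        then have "clique G (insert u K)" using cl u parcs_symD unfolding clique_def by auto
        then show False using ext u by blast
      qed
    qed
    moreover have "\<forall>z\<in>K. c z = c x"
      using mono xy unfolding monochromatic_def c'_def by (metis one_eq_numeral_iff semiring_norm(85))
    ultimately show False using valid_onD[OF c _ _ xy] cl unfolding clique_def by blast
  qed
  moreover have "c' ` pverts G \<subseteq> {1..2}" by (auto simp: c'_def)
  ultimately show ?thesis unfolding clique_colorable_def by blast
qed

end
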